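(* Let $\theta_S,\theta_B\ge0$ and $\nu>0$. Let $\mathbf u^*\in\mathcal U_{ad}$ be a local minimizer for the problem $$\inf_{\mathbf u\in\mathcal U_{ad}}\mathcal J_{\theta,\nu}(\mathbf u),\qquad \mathcal J_{\theta,\nu}(\mathbf u)=C_T(\mathbf u)+\frac{\theta_S}2S(\mathbf u)+\theta_BB_\nu(\mathbf u),$$ and let $(\boldsymbol\rho,\boldsymbol\gamma)$ be the solution of the controlled system associated with $\mathbf u^*$. Then $\mathbf u^*$ satisfies the first order necessary condition $$\Lambda(\cdot)=0\quad\text{a.e. on }[0,T],$$ where $\Lambda:[0,T]\to\mathbb R^{N_r}$ is defined by $$\Lambda(t)=\min\big\{\mathbf u^*(t),\max\{\mathbf u^*(t)-1,\nabla_{\mathbf u}\mathcal J_{\theta,\nu}(\mathbf u^* )(t)\}\big\},$$ the min, max and subtraction of $1$ being understood componentwise, and $$\nabla_{\mathbf u}\mathcal J_{\theta,\nu}(\mathbf u^* )(t)=N(\boldsymbol\rho(t),\boldsymbol\gamma(t),\mathbf u^*(t))^\top\mathbf p^*(t)+\theta_S\Big(\sum_{i=1}^{N_r}u_i^*(t)-N_{\max}\Big)_+\mathbf 1+\theta_B\sum_{i=1}^{N_r}\nabla_{\mathbf u}\operatorname{TV}_\nu(u_i^* )(t),$$ with $\mathbf 1=(1,\dots,1)\in\mathbb R^{N_r}$, $\mathbf p^*$ the adjoint state associated with $\mathbf u^*$, and $\nabla_{\mathbf u}$ the gradient with respect to $\mathbf u$ in $L^2(0,T)$.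
   Context: **Model.** There are $N_r\ge1$ roads, each divided into $N_c\ge2$ cells of lengths $\Delta x_{i,j}>0$. The state is $\boldsymbol\rho=(\rho_{i,j})_{1\le i\le N_r,1\le j\le N_c}$, the boundary fluxes are $\boldsymbol\gamma=(\gamma_1^L,\gamma_1^R,\dots,\gamma_{N_r}^L,\gamma_{N_r}^R)\in\mathbb R^{2N_r}$, and $f_i(\rho)=\rho(1-\rho)$. The finite volume field is $$f^{FV}(\boldsymbol\rho,\boldsymbol\gamma)_{i,j}=\begin{cases}-\frac1{\Delta x_{i,j}}\big(\mathcal F_i(\rho_{i,j},\rho_{i,j+1})-\gamma_i^L\big)& j=1,\\ -\frac1{\Delta x_{i,j}}\big(\mathcal F_i(\rho_{i,j},\rho_{i,j+1})-\mathcal F_i(\rho_{i,j-1},\rho_{i,j})\big)&2\le j\le N_c-1,\\ -\frac1{\Delta x_{i,j}}\big(\gamma_i^R-\mathcal F_i(\rho_{i,j-1},\rho_{i,j})\big)&j=N_c,\end{cases}$$ where $\mathcal F_i:\mathbb R^2\to\mathbb R$ is (a $C^1$ regularization of) the local Lax–Friedrichs flux $\mathcal F_i(u,v)=\frac{f_i(u)+f_i(v)}2-\max\{|f_i'(u)|,|f_i'(v)|\}\frac{v-u}2$. The map $\phi^{LP}:\mathbb R^{N_r\times N_c}\times\mathbb R^{N_r}\to\mathbb R^{2N_r}$, $(\boldsymbol\rho,\mathbf u)\mapsto\boldsymbol\gamma$, is a fixed $C^1$ regularization of the map which gives the fluxes at the junctions of the road network (obtained by solving a linear program at each junction maximizing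 total incoming flux under capacity constraints weighted by the controls). Controlled system, with $T>0$ and initial density $\boldsymbol\rho_0\in[0,1]^{N_r\times N_c}$ fixed: $$\boldsymbol\rho'(t)=f^{FV}(\boldsymbol\rho(t),\boldsymbol\gamma(t)),\quad \boldsymbol\gamma(t)=\phi^{LP}(\boldsymbol\rho(t),\mathbf u(t)),\quad t\in(0,T),\qquad \boldsymbol\rho(0)=\boldsymbol\rho_0 .$$ Standing assumptions (differentiable framework): $f^{FV}$ and $\phi^{LP}$ are of class $C^1$, and for every $\mathbf u\in\mathcal U_{ad}:=L^\infty([0,T],[0,1]^{N_r})$ the controlled system has a unique absolutely continuous solution $\boldsymbol\rho(\cdot;\mathbf u)$ on $[0,T]$. **Functionals.** Given $\chi_{\rm path}\subset\{1,\dots,N_r\}$ and $N_{\max}\in\mathbb N^*$, let $\mathbf c=(c_{i,j})$ with $c_{i,j}=1$ if $i\in\chi_{\rm path}$ and $0$ otherwise, and $$C_T(\mathbf u)=\mathbf c\cdot\boldsymbol\rho(T;\mathbf u),\quad S(\mathbf u)=\int_0^T\Big(\sum_{i=1}^{N_r}u_i(t)-N_{\max}\Big)_+^2dt,\quad B_\nu(\mathbf u)=\sum_{i=1}^{N_r}\operatorname{TV}_\nu(u_i),$$ where $x_+=\max\{x,0\}$ and $\operatorname{TV}_\nu:L^2(0,T)\to\mathbb R$ is a given differentiable functional (an approximation of the total variation, with regularization parameter $\nu>0$). The gradient $\nabla_{\mathbf u}\operatorname{TV}_\nu(u_i)$ is the $L^2(0,T;\mathbb R^{N_r})$-gradient of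 $\mathbf u\mapsto\operatorname{TV}_\nu(u_i)$; only its $i$-th component is nonzero. **Local minimizer.** $\mathbf u^*\in\mathcal U_{ad}$ such that $\mathcal J_{\theta,\nu}(\mathbf u^* )\le\mathcal J_{\theta,\nu}(\mathbf u)$ for all $\mathbf u\in\mathcal U_{ad}$ sufficiently close to $\mathbf u^*$ in $L^\infty(0,T)$. **Matrices and adjoint state.** With $\partial_xF$ the Jacobian matrix of $F$ in the variable $x$, $$M(\boldsymbol\rho,\boldsymbol\gamma,\mathbf u)=(\partial_{\boldsymbol\rho}f^{FV})(\boldsymbol\rho,\boldsymbol\gamma)+(\partial_{\boldsymbol\gamma}f^{FV})(\boldsymbol\rho,\boldsymbol\gamma)(\partial_{\boldsymbol\rho}\phi^{LP})(\boldsymbol\rho,\mathbf u),\quad N(\boldsymbol\rho,\boldsymbol\gamma,\mathbf u)=(\partial_{\boldsymbol\gamma}f^{FV})(\boldsymbol\rho,\boldsymbol\gamma)(\partial_{\mathbf u}\phi^{LP})(\boldsymbol\rho,\mathbf u).$$ The adjoint state $\mathbf p^*$ associated with $\mathbf u^*$ is the unique solution of $\mathbf p'+M(\boldsymbol\rho,\boldsymbol\gamma,\mathbf u^* )^\top\mathbf p=0$ in $(0,T)$, $\mathbf p(T)=\mathbf c$, where $(\boldsymbol\rho,\boldsymbol\gamma)$ is the solution associated with $\mathbf u^*$. *)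

theory Defs
  imports "HOL-Analysis.Analysis"
begin

text \<open>
  Roads are indexed by a finite type \<open>'r\<close> and the cells of each road by a finite linearly ordered
  type \<open>'c\<close>, so that \<open>N\<^sub>r = CARD('r)\<close>, \<open>N\<^sub>c = CARD('c)\<close> and cell number \<open>j\<close> is the \<open>j\<close>-th element
  of \<open>'c\<close>.  The density matrix is a vector indexed by \<open>'r \<times> 'c\<close>, so that Jacobians are
  ordinary matrices.
\<close>

type_synonym ('r, 'c) density = "real ^ ('r \<times> 'c)"

text \<open>\<open>Left_End\<close> is the upstream boundary of a road (flux \<open>\<gamma>\<^sup>L\<close>), \<open>Right_End\<close> the downstream one.\<close>

datatype road_end = Left_End | Right_End

instance road_end :: finite
proof
  have "UNIV = {Left_End, Right_End}"
    using road_end.exhaust by auto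
  then show "finite (UNIV :: road_end set)"
    by (metis finite.emptyI finite.insertI)
qed

type_synonym 'r fluxes = "real ^ ('r \<times> road_end)"
type_synonym 'r control = "real \<Rightarrow> real ^ 'r"


section \<open>Finite volume field\<close>

definition C1 :: "('a::real_normed_vector \<Rightarrow> 'b::real_normed_vector) \<Rightarrow> bool" where
  "C1 f \<longleftrightarrow> (\<exists>f' :: 'a \<Rightarrow> 'a \<Rightarrow>\<^sub>L 'b.
     (\<forall>x. (f has_derivative blinfun_apply (f' x)) (at x)) \<and> continuous_on UNIV f')"

text \<open>\<open>f\<^sub>i(\<rho>) = \<rho>(1 - \<rho>)\<close> on every road, so the local Lax--Friedrichs flux does not depend on \<open>i\<close>.\<close>

definition traffic_flux :: "real \<Rightarrow> real" where
  "traffic_flux \<rho> = \<rho> * (1 - \<rho>)"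

definition llf_flux :: "real \<times> real \<Rightarrow> real" where
  "llf_flux = (\<lambda>(u, v). (traffic_flux u + traffic_flux v) / 2
     - max \<bar>deriv traffic_flux u\<bar> \<bar>deriv traffic_flux v\<bar> * ((v - u) / 2))"

text \<open>
  A family of \<open>C\<^sup>1\<close> functions \<open>G \<epsilon>\<close>, \<open>\<epsilon> > 0\<close>, that approximates \<open>F\<close> locally uniformly
  as \<open>\<epsilon>\<close> tends to \<open>0\<close>.
\<close>

definition C1_regularization ::
    "(real \<Rightarrow> 'a::real_normed_vector \<Rightarrow> 'b::real_normed_vector) \<Rightarrow> ('a \<Rightarrow> 'b) \<Rightarrow> bool" where
  "C1_regularization G F \<longleftrightarrow>
     (\<forall>\<epsilon>>0. C1 (G \<epsilon>)) \<and> (\<forall>K. compact K \<longrightarrow> uniform_limit K G F (at_right 0))"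

definition first_cell :: "'c::{finite,linorder}" where
  "first_cell = Min UNIV"

definition last_cell :: "'c::{finite,linorder}" where
  "last_cell = Max UNIV"

text \<open>The cells \<open>j + 1\<close> and \<open>j - 1\<close>; only used where they exist.\<close>

definition next_cell :: "'c::{finite,linorder} \<Rightarrow> 'c" where
  "next_cell j = Min {k. j < k}"

definition prev_cell :: "'c::{finite,linorder} \<Rightarrow> 'c" where
  "prev_cell j = Max {k. k < j}"

definition fv_field :: "('r::finite, 'c::{finite,linorder}) density \<Rightarrow> ('r \<Rightarrow> real \<times> real \<Rightarrow> real) \<Rightarrow>
    ('r, 'c) density \<times> 'r fluxes \<Rightarrow> ('r, 'c) density" where
  "fv_field \<Delta>x F = (\<lambda>(\<rho>, \<gamma>). \<chi> k. case k of (i, j) \<Rightarrow>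
     if j = first_cell then
       - (1 / \<Delta>x $ (i, j)) * (F i (\<rho> $ (i, j), \<rho> $ (i, next_cell j)) - \<gamma> $ (i, Left_End))
     else if j = last_cell then
       - (1 / \<Delta>x $ (i, j)) * (\<gamma> $ (i, Right_End) - F i (\<rho> $ (i, prev_cell j), \<rho> $ (i, j)))
     else
       - (1 / \<Delta>x $ (i, j)) * (F i (\<rho> $ (i, j), \<rho> $ (i, next_cell j))
                             - F i (\<rho> $ (i, prev_cell j), \<rho> $ (i, j))))"


section \<open>The controlled system\<close>

definition abs_continuous_on_interval :: "real \<Rightarrow> real \<Rightarrow> (real \<Rightarrow> 'a::real_normed_vector) \<Rightarrow> bool" where
  "abs_continuous_on_interval a b f \<longleftrightarrow> (\<forall>\<epsilon>>0. \<exists>\<delta>>0. \<forall>D :: (real \<times> real) set.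
     finite D \<and> (\<forall>(s, t)\<in>D. a \<le> s \<and> s \<le> t \<and> t \<le> b) \<and>
     pairwise (\<lambda>(s, t) (s', t'). {s<..<t} \<inter> {s'<..<t'} = {}) D \<and>
     (\<Sum>(s, t)\<in>D. t - s) < \<delta> \<longrightarrow> (\<Sum>(s, t)\<in>D. norm (f t - f s)) < \<epsilon>)"

text \<open>
  \<open>L\<^sup>\<infinity>([0,T],[0,1]\<^bsup>N\<^sub>r\<^esup>)\<close>.  Elements of Lebesgue spaces on \<open>(0,T)\<close> are represented by functions on
  the real line of which only the values almost everywhere on \<open>[0,T]\<close> matter.
\<close>

definition U_ad :: "real \<Rightarrow> ('r::finite) control set" where
  "U_ad T = {u \<in> borel_measurable (lebesgue_on {0..T}).
               AE t in lebesgue_on {0..T}. \<forall>i. 0 \<le> u t $ i \<and> u t $ i \<le> 1}"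

definition solves_system :: "(('r::finite, 'c::finite) density \<times> 'r fluxes \<Rightarrow> ('r, 'c) density) \<Rightarrow>
    (('r, 'c) density \<times> (real ^ 'r) \<Rightarrow> 'r fluxes) \<Rightarrow> real \<Rightarrow> ('r, 'c) density \<Rightarrow> 'r control \<Rightarrow>
    (real \<Rightarrow> ('r, 'c) density) \<Rightarrow> (real \<Rightarrow> 'r fluxes) \<Rightarrow> bool" where
  "solves_system f \<phi> T \<rho>0 u \<rho> \<gamma> \<longleftrightarrow>
     abs_continuous_on_interval 0 T \<rho> \<and> \<rho> 0 = \<rho>0 \<and>
     (AE t in lebesgue_on {0..T}. (\<rho> has_vector_derivative f (\<rho> t, \<gamma> t)) (at t)) \<and>
     (AE t in lebesgue_on {0..T}. \<gamma> t = \<phi> (\<rho> t, u t))"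

text \<open>\<open>\<rho>(\<cdot>; u)\<close>, meaningful on \<open>[0,T]\<close> whenever the system has exactly one solution there.\<close>

definition density_of :: "(('r::finite, 'c::finite) density \<times> 'r fluxes \<Rightarrow> ('r, 'c) density) \<Rightarrow>
    (('r, 'c) density \<times> (real ^ 'r) \<Rightarrow> 'r fluxes) \<Rightarrow> real \<Rightarrow> ('r, 'c) density \<Rightarrow> 'r control \<Rightarrow>
    real \<Rightarrow> ('r, 'c) density" where
  "density_of f \<phi> T \<rho>0 u = (SOME \<rho>. \<exists>\<gamma>. solves_system f \<phi> T \<rho>0 u \<rho> \<gamma>)"


section \<open>Square integrable functions, derivatives and gradients\<close>

definition L2 :: "real \<Rightarrow> (real \<Rightarrow> 'a::euclidean_space) set" where
  "L2 T = {v \<in> borel_measurable (lebesgue_on {0..T}).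
             integrable (lebesgue_on {0..T}) (\<lambda>t. (norm (v t))\<^sup>2)}"

definition norm_L2 :: "real \<Rightarrow> (real \<Rightarrow> 'a::euclidean_space) \<Rightarrow> real" where
  "norm_L2 T v = sqrt (LINT t|lebesgue_on {0..T}. (norm (v t))\<^sup>2)"

definition inner_L2 :: "real \<Rightarrow> (real \<Rightarrow> 'a::euclidean_space) \<Rightarrow> (real \<Rightarrow> 'a) \<Rightarrow> real" where
  "inner_L2 T v w = (LINT t|lebesgue_on {0..T}. v t \<bullet> w t)"

text \<open>Compatibility with almost everywhere equality: \<open>\<Phi>\<close> is a functional on \<open>L\<^sup>2(0,T)\<close>.\<close>

definition L2_functional :: "real \<Rightarrow> ((real \<Rightarrow> 'a::euclidean_space) \<Rightarrow> real) \<Rightarrow> bool" where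
  "L2_functional T \<Phi> \<longleftrightarrow>
     (\<forall>v\<in>L2 T. \<forall>w\<in>L2 T. (AE t in lebesgue_on {0..T}. v t = w t) \<longrightarrow> \<Phi> v = \<Phi> w)"

text \<open>Frechet differentiability on \<open>L\<^sup>2(0,T)\<close>; the derivative is a bounded linear functional \<open>D\<close>.\<close>

definition L2_differentiable_at ::
    "real \<Rightarrow> ((real \<Rightarrow> 'a::euclidean_space) \<Rightarrow> real) \<Rightarrow> (real \<Rightarrow> 'a) \<Rightarrow> bool" where
  "L2_differentiable_at T \<Phi> v \<longleftrightarrow> (\<exists>D :: (real \<Rightarrow> 'a) \<Rightarrow> real.
     (\<forall>g\<in>L2 T. \<forall>h\<in>L2 T. D (\<lambda>t. g t + h t) = D g + D h) \<and>
     (\<forall>a. \<forall>h\<in>L2 T. D (\<lambda>t. a *\<^sub>R h t) = a * D h) \<and>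
     (\<exists>K. \<forall>h\<in>L2 T. \<bar>D h\<bar> \<le> K * norm_L2 T h) \<and>
     (\<forall>\<epsilon>>0. \<exists>\<delta>>0. \<forall>h\<in>L2 T. norm_L2 T h < \<delta> \<longrightarrow>
        \<bar>\<Phi> (\<lambda>t. v t + h t) - \<Phi> v - D h\<bar> \<le> \<epsilon> * norm_L2 T h))"

text \<open>
  \<open>g\<close> is the \<open>L\<^sup>2\<close>-gradient at \<open>u\<close> of a functional \<open>\<Phi>\<close> with domain \<open>U\<close>: it is the Riesz
  representative of the Frechet derivative.  The domain matters because the terminal cost is
  only defined on admissible controls.
\<close>

definition has_L2_gradient :: "real \<Rightarrow> (real \<Rightarrow> 'a::euclidean_space) set \<Rightarrow>
    ((real \<Rightarrow> 'a) \<Rightarrow> real) \<Rightarrow> (real \<Rightarrow> 'a) \<Rightarrow> (real \<Rightarrow> 'a) \<Rightarrow> bool" where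
  "has_L2_gradient T U \<Phi> u g \<longleftrightarrow> g \<in> L2 T \<and>
     (\<forall>\<epsilon>>0. \<exists>\<delta>>0. \<forall>v\<in>U. norm_L2 T (\<lambda>t. v t - u t) < \<delta> \<longrightarrow>
        \<bar>\<Phi> v - \<Phi> u - inner_L2 T g (\<lambda>t. v t - u t)\<bar> \<le> \<epsilon> * norm_L2 T (\<lambda>t. v t - u t))"


section \<open>Cost functional and local minimizers\<close>

definition path_vector :: "'r set \<Rightarrow> ('r::finite, 'c::finite) density" where
  "path_vector \<chi>path = (\<chi> k. if fst k \<in> \<chi>path then 1 else 0)"

definition pos_part :: "real \<Rightarrow> real" where
  "pos_part x = max x 0"

definition S_cost :: "real \<Rightarrow> nat \<Rightarrow> ('r::finite) control \<Rightarrow> real" where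
  "S_cost T Nmax u =
     (LINT t|lebesgue_on {0..T}. (pos_part ((\<Sum>i\<in>UNIV. u t $ i) - real Nmax))\<^sup>2)"

definition B_cost :: "((real \<Rightarrow> real) \<Rightarrow> real) \<Rightarrow> ('r::finite) control \<Rightarrow> real" where
  "B_cost TV u = (\<Sum>i\<in>UNIV. TV (\<lambda>t. u t $ i))"

text \<open>The almost everywhere bound says that the \<open>L\<^sup>\<infinity>(0,T)\<close> distance is at most \<open>\<delta>\<close>.\<close>

definition local_minimizer :: "real \<Rightarrow> (('r::finite) control \<Rightarrow> real) \<Rightarrow> 'r control \<Rightarrow> bool" where
  "local_minimizer T J u \<longleftrightarrow> u \<in> U_ad T \<and>
     (\<exists>\<delta>>0. \<forall>v\<in>U_ad T. (AE t in lebesgue_on {0..T}. norm (v t - u t) \<le> \<delta>) \<longrightarrow> J u \<le> J v)"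


section \<open>Adjoint system\<close>

definition M_matrix :: "(('r::finite, 'c::finite) density \<times> 'r fluxes \<Rightarrow> ('r, 'c) density) \<Rightarrow>
    (('r, 'c) density \<times> (real ^ 'r) \<Rightarrow> 'r fluxes) \<Rightarrow>
    ('r, 'c) density \<Rightarrow> 'r fluxes \<Rightarrow> real ^ 'r \<Rightarrow> real ^ ('r \<times> 'c) ^ ('r \<times> 'c)" where
  "M_matrix f \<phi> \<rho> \<gamma> u = jacobian (\<lambda>r. f (r, \<gamma>)) (at \<rho>)
     + jacobian (\<lambda>g. f (\<rho>, g)) (at \<gamma>) ** jacobian (\<lambda>r. \<phi> (r, u)) (at \<rho>)"

definition N_matrix :: "(('r::finite, 'c::finite) density \<times> 'r fluxes \<Rightarrow> ('r, 'c) density) \<Rightarrow>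
    (('r, 'c) density \<times> (real ^ 'r) \<Rightarrow> 'r fluxes) \<Rightarrow>
    ('r, 'c) density \<Rightarrow> 'r fluxes \<Rightarrow> real ^ 'r \<Rightarrow> real ^ 'r ^ ('r \<times> 'c)" where
  "N_matrix f \<phi> \<rho> \<gamma> u =
     jacobian (\<lambda>g. f (\<rho>, g)) (at \<gamma>) ** jacobian (\<lambda>v. \<phi> (\<rho>, v)) (at u)"

text \<open>The coefficient matrix is only measurable in time, so \<open>p\<close> is absolutely continuous.\<close>

definition adjoint_state :: "(('r::finite, 'c::finite) density \<times> 'r fluxes \<Rightarrow> ('r, 'c) density) \<Rightarrow>
    (('r, 'c) density \<times> (real ^ 'r) \<Rightarrow> 'r fluxes) \<Rightarrow> real \<Rightarrow> ('r, 'c) density \<Rightarrow> 'r control \<Rightarrow>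
    (real \<Rightarrow> ('r, 'c) density) \<Rightarrow> (real \<Rightarrow> 'r fluxes) \<Rightarrow> (real \<Rightarrow> ('r, 'c) density) \<Rightarrow> bool" where
  "adjoint_state f \<phi> T c u \<rho> \<gamma> p \<longleftrightarrow>
     abs_continuous_on_interval 0 T p \<and> p T = c \<and>
     (AE t in lebesgue_on {0..T}.
        (p has_vector_derivative - (transpose (M_matrix f \<phi> (\<rho> t) (\<gamma> t) (u t)) *v p t)) (at t))"

end

theory Submission
  imports Defs
begin

text \<open>
  Substituting the junction fluxes turns the controlled system into a single ordinary differential
  equation \<open>\<rho>' = G(\<rho>,u)\<close> with \<open>G(\<rho>,u) = f\<^sup>F\<^sup>V(\<rho>, \<phi>\<^sup>L\<^sup>P(\<rho>,u))\<close> of class \<open>C\<^sup>1\<close>; the matrices \<open>M\<close> and \<open>N\<close> are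
  the partial Jacobians of \<open>G\<close> along the trajectory.

  The gradient formula for the terminal cost is the adjoint identity.  Let \<open>y\<close> be the trajectory of
  an admissible control \<open>v\<close> and put \<open>h = v - u\<close>, \<open>\<delta> = y - \<rho>\<close>.  The function \<open>p \<bullet> \<delta>\<close> is absolutely
  continuous, vanishes at \<open>0\<close>, and by the adjoint equation has derivative \<open>p \<bullet> \<partial>\<^sub>uG h + p \<bullet> R\<close>, where
  \<open>R\<close> is the first order Taylor remainder of \<open>G\<close>.  Integration gives
  \<open>c \<bullet> \<delta>(T) = \<integral> N\<^sup>T p \<bullet> h + \<integral> p \<bullet> R\<close>, so it remains to see that \<open>\<integral> \<bar>R\<bar>\<close> is \<open>o(\<parallel>h\<parallel>)\<close> in the \<open>L\<^sup>2\<close>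
  norm.  Two facts give this.  Gronwall's inequality yields \<open>sup \<bar>\<delta>\<bar> \<le> C \<integral> \<bar>h\<bar>\<close>
  for \<open>v\<close> near \<open>u\<close> (\<open>trajectory_stability\<close>).  Smallness of \<open>h\<close> in \<open>L\<^sup>2\<close> does not make \<open>h\<close> pointwise small, but
  on a compact convex set \<open>\<bar>R\<bar> \<le> \<epsilon> \<bar>(\<delta>,h)\<bar> + C\<^sub>\<epsilon> \<bar>(\<delta>,h)\<bar>\<^sup>2\<close> holds for increments of any size
  (\<open>taylor_remainder_on_compact\<close>), and the quadratic term integrates to \<open>O(\<parallel>h\<parallel>\<^sup>2)\<close>.  Since \<open>p\<close> and
  \<open>\<delta>\<close> are differentiable only almost everywhere, the fundamental theorem of calculus for absolutely
  continuous functions is needed; it is proved directly with gauge integrals.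

  The penalty \<open>S\<close> is differentiable because \<open>x \<mapsto> (x\<^sub>+)\<^sup>2\<close> has a quadratic Taylor remainder, and the
  gradients of the total variation terms are given.

  For the necessary condition, let \<open>g\<close> be the gradient.  As the admissible set is convex, local
  minimality gives \<open>\<integral> g \<bullet> (w - u) \<ge> 0\<close> for all admissible \<open>w\<close>.  Taking for \<open>w\<^sub>i(t)\<close> the value \<open>0\<close> where
  \<open>g\<^sub>i(t) > 0\<close>, the value \<open>1\<close> where \<open>g\<^sub>i(t) < 0\<close>, and \<open>u\<^sub>i(t)\<close> elsewhere makes every summand
  \<open>g\<^sub>i (w\<^sub>i - u\<^sub>i)\<close> nonpositive, hence zero almost everywhere: \<open>u\<^sub>i = 0\<close> where \<open>g\<^sub>i > 0\<close> and \<open>u\<^sub>i = 1\<close> where \<open>g\<^sub>i < 0\<close>, which is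
  \<open>\<Lambda> = 0\<close>.
\<close>

section \<open>Absolutely continuous functions\<close>

text \<open>A finite family of subintervals of \<open>[a,b]\<close>, given by their end points, whose interiors are
  pairwise disjoint.\<close>

definition nonoverlapping :: "real \<Rightarrow> real \<Rightarrow> (real \<times> real) set \<Rightarrow> bool" where
  "nonoverlapping a b D \<longleftrightarrow> finite D \<and> (\<forall>(s, t)\<in>D. a \<le> s \<and> s \<le> t \<and> t \<le> b) \<and>
     pairwise (\<lambda>(s, t) (s', t'). {s<..<t} \<inter> {s'<..<t'} = {}) D"

lemma ac_iff:
  "abs_continuous_on_interval a b f \<longleftrightarrow> (\<forall>\<epsilon>>0. \<exists>\<delta>>0. \<forall>D. nonoverlapping a b D \<and>
     (\<Sum>(s, t)\<in>D. t - s) < \<delta> \<longrightarrow> (\<Sum>(s, t)\<in>D. norm (f t - f s)) < \<epsilon>)"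
  unfolding abs_continuous_on_interval_def nonoverlapping_def conj_assoc ..

lemma acE:
  assumes "abs_continuous_on_interval a b f" "\<epsilon> > 0"
  obtains \<delta> where "\<delta> > 0"
    "\<And>D. \<lbrakk>nonoverlapping a b D; (\<Sum>(s, t)\<in>D. t - s) < \<delta>\<rbrakk> \<Longrightarrow> (\<Sum>(s, t)\<in>D. norm (f t - f s)) < \<epsilon>"
  using assms unfolding ac_iff by blast

lemma acI:
  assumes "\<And>\<epsilon>. \<epsilon> > 0 \<Longrightarrow> \<exists>\<delta>>0. \<forall>D. nonoverlapping a b D \<longrightarrow>
     (\<Sum>(s, t)\<in>D. t - s) < \<delta> \<longrightarrow> (\<Sum>(s, t)\<in>D. norm (f t - f s)) < \<epsilon>"
  shows "abs_continuous_on_interval a b f"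
  using assms unfolding ac_iff by blast

lemma ac_subinterval:
  assumes "abs_continuous_on_interval a b f" "a \<le> c" "d \<le> b"
  shows "abs_continuous_on_interval c d f"
proof (rule acI)
  fix e :: real
  assume "e > 0"
  then obtain \<delta> where "\<delta> > 0" and \<delta>: "\<And>D. \<lbrakk>nonoverlapping a b D; (\<Sum>(s, t)\<in>D. t - s) < \<delta>\<rbrakk> \<Longrightarrow>
      (\<Sum>(s, t)\<in>D. norm (f t - f s)) < e"
    using acE[OF assms(1)] by blast
  have "nonoverlapping a b D" if "nonoverlapping c d D" for D
    using that assms(2,3) unfolding nonoverlapping_def by fastforce
  with \<delta> \<open>\<delta> > 0\<close> show "\<exists>\<delta>>0. \<forall>D. nonoverlapping c d D \<longrightarrow>
     (\<Sum>(s, t)\<in>D. t - s) < \<delta> \<longrightarrow> (\<Sum>(s, t)\<in>D. norm (f t - f s)) < e"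
    by blast
qed

lemma ac_continuous_on:
  assumes "abs_continuous_on_interval a b f"
  shows "continuous_on {a..b} f"
  unfolding continuous_on_iff
proof (intro ballI allI impI)
  fix x and e :: real
  assume x: "x \<in> {a..b}" and "e > 0"
  obtain \<delta> where "\<delta> > 0" and \<delta>: "\<And>D. \<lbrakk>nonoverlapping a b D; (\<Sum>(s, t)\<in>D. t - s) < \<delta>\<rbrakk> \<Longrightarrow>
      (\<Sum>(s, t)\<in>D. norm (f t - f s)) < e"
    using acE[OF assms \<open>e > 0\<close>] by blast
  have "dist (f y) (f x) < e" if y: "y \<in> {a..b}" "dist y x < \<delta>" for y
  proof -
    have "(\<Sum>(s, t)\<in>{(min x y, max x y)}. norm (f t - f s)) < e"
      using x y by (intro \<delta>) (auto simp: nonoverlapping_def dist_real_def)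
    then show ?thesis
      by (auto simp: dist_norm min_def max_def norm_minus_commute split: if_splits)
  qed
  then show "\<exists>d>0. \<forall>x'\<in>{a..b}. dist x' x < d \<longrightarrow> dist (f x') (f x) < e"
    using \<open>\<delta> > 0\<close> by blast
qed

text \<open>Absolute continuity passes to any function whose increments are dominated by those of two
  absolutely continuous ones.\<close>

lemma ac_dominated:
  assumes f: "abs_continuous_on_interval a b f" and g: "abs_continuous_on_interval a b g"
    and dom: "\<And>s t. \<lbrakk>s \<in> {a..b}; t \<in> {a..b}\<rbrakk> \<Longrightarrow>
      norm (h t - h s) \<le> K * (norm (f t - f s) + norm (g t - g s))"
  shows "abs_continuous_on_interval a b h"
proof (rule acI)
  fix e :: real
  assume "e > 0"
  define K' where "K' = \<bar>K\<bar> + 1"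
  have "K' > 0" "K \<le> K'" by (auto simp: K'_def)
  define e' where "e' = e / (2 * K')"
  have "e' > 0" using \<open>e > 0\<close> \<open>K' > 0\<close> by (simp add: e'_def)
  from f \<open>e' > 0\<close> obtain \<delta>1 where "\<delta>1 > 0" and \<delta>1: "\<And>D. \<lbrakk>nonoverlapping a b D; (\<Sum>(s, t)\<in>D. t - s) < \<delta>1\<rbrakk> \<Longrightarrow>
        (\<Sum>(s, t)\<in>D. norm (f t - f s)) < e'"
    using acE[OF f] by auto
  from g \<open>e' > 0\<close> obtain \<delta>2 where "\<delta>2 > 0" and \<delta>2: "\<And>D. \<lbrakk>nonoverlapping a b D; (\<Sum>(s, t)\<in>D. t - s) < \<delta>2\<rbrakk> \<Longrightarrow>
        (\<Sum>(s, t)\<in>D. norm (g t - g s)) < e'"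
    using acE[OF g] by auto
  show "\<exists>\<delta>>0. \<forall>D. nonoverlapping a b D \<longrightarrow>
     (\<Sum>(s, t)\<in>D. t - s) < \<delta> \<longrightarrow> (\<Sum>(s, t)\<in>D. norm (h t - h s)) < e"
  proof (intro exI[of _ "min \<delta>1 \<delta>2"] conjI allI impI)
    fix D
    assume D: "nonoverlapping a b D" "(\<Sum>(s, t)\<in>D. t - s) < min \<delta>1 \<delta>2"
    have "(\<Sum>(s, t)\<in>D. norm (h t - h s)) \<le>
        (\<Sum>(s, t)\<in>D. K' * (norm (f t - f s) + norm (g t - g s)))"
    proof (rule sum_mono, clarify)
      fix s t assume "(s, t) \<in> D"
      then have "a \<le> s \<and> s \<le> t \<and> t \<le> b"
        using D(1) by (auto simp: nonoverlapping_def)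
      then have "norm (h t - h s) \<le> K * (norm (f t - f s) + norm (g t - g s))"
        by (intro dom) auto
      also have "\<dots> \<le> K' * (norm (f t - f s) + norm (g t - g s))"
        using \<open>K \<le> K'\<close> by (intro mult_right_mono) auto
      finally show "norm (h t - h s) \<le> K' * (norm (f t - f s) + norm (g t - g s))" .
    qed
    also have "\<dots> = K' * ((\<Sum>(s, t)\<in>D. norm (f t - f s)) + (\<Sum>(s, t)\<in>D. norm (g t - g s)))"
      by (simp add: sum_distrib_left[symmetric] sum.distrib[symmetric] split_beta)
    also have "\<dots> < K' * (e' + e')"
      using D \<open>K' > 0\<close> by (intro mult_strict_left_mono add_strict_mono \<delta>1 \<delta>2) auto
    also have "\<dots> = e" using \<open>K' > 0\<close> by (simp add: e'_def field_simps)
    finally show "(\<Sum>(s, t)\<in>D. norm (h t - h s)) < e" .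
  qed (use \<open>\<delta>1 > 0\<close> \<open>\<delta>2 > 0\<close> in auto)
qed

lemma ac_diff:
  assumes "abs_continuous_on_interval a b f" "abs_continuous_on_interval a b g"
  shows "abs_continuous_on_interval a b (\<lambda>t. f t - g t)"
proof (rule ac_dominated[OF assms, where K = 1])
  fix s t
  have "f t - g t - (f s - g s) = (f t - f s) - (g t - g s)" by simp
  then show "norm (f t - g t - (f s - g s)) \<le> 1 * (norm (f t - f s) + norm (g t - g s))"
    by (metis norm_triangle_ineq4 mult_1)
qed

lemma ac_bounded:
  assumes "abs_continuous_on_interval a b f"
  obtains B where "B \<ge> 0" "\<And>t. t \<in> {a..b} \<Longrightarrow> norm (f t) \<le> B"
proof -
  have "bounded (f ` {a..b})"
    using ac_continuous_on[OF assms] compact_Icc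
    by (intro compact_imp_bounded compact_continuous_image) auto
  then obtain B where "\<forall>y\<in>f ` {a..b}. norm y \<le> B" by (auto simp: bounded_iff)
  then show ?thesis by (intro that[of "max B 0"]) (auto simp: le_max_iff_disj)
qed

lemma ac_inner:
  fixes f g :: "real \<Rightarrow> 'a::real_inner"
  assumes f: "abs_continuous_on_interval a b f" and g: "abs_continuous_on_interval a b g"
  shows "abs_continuous_on_interval a b (\<lambda>t. f t \<bullet> g t)"
proof -
  obtain A where A: "A \<ge> 0" "\<And>t. t \<in> {a..b} \<Longrightarrow> norm (f t) \<le> A"
    using ac_bounded[OF f] by blast
  obtain B where B: "B \<ge> 0" "\<And>t. t \<in> {a..b} \<Longrightarrow> norm (g t) \<le> B"
    using ac_bounded[OF g] by blast
  show ?thesis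
  proof (rule ac_dominated[OF f g, where K = "A + B"])
    fix s t assume st: "s \<in> {a..b}" "t \<in> {a..b}"
    have "f t \<bullet> g t - f s \<bullet> g s = (f t - f s) \<bullet> g t + f s \<bullet> (g t - g s)"
      by (simp add: inner_diff_left inner_diff_right)
    then have "norm (f t \<bullet> g t - f s \<bullet> g s) \<le> \<bar>(f t - f s) \<bullet> g t\<bar> + \<bar>f s \<bullet> (g t - g s)\<bar>"
      by simp
    also have "\<dots> \<le> norm (f t - f s) * norm (g t) + norm (f s) * norm (g t - g s)"
      by (intro add_mono Cauchy_Schwarz_ineq2)
    also have "\<dots> \<le> norm (f t - f s) * (A + B) + (A + B) * norm (g t - g s)"
      using st A B by (intro add_mono mult_left_mono mult_right_mono)
        (auto intro: add_increasing add_increasing2)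
    finally show "norm (f t \<bullet> g t - f s \<bullet> g s) \<le> (A + B) * (norm (f t - f s) + norm (g t - g s))"
      by (simp add: algebra_simps)
  qed
qed

text \<open>The fundamental theorem of calculus.  In the Riemann sums over a fine tagged division, the
  intervals tagged outside the exceptional null set are controlled by differentiability; those tagged
  in it have small total length, because the indicator of the null set has gauge integral \<open>0\<close>, hence
  contribute little by absolute continuity.\<close>

lemma ac_fundamental_theorem:
  fixes f :: "real \<Rightarrow> 'a::banach"
  assumes "a \<le> b" and ac: "abs_continuous_on_interval a b f" and N: "negligible N"
    and der: "\<And>t. \<lbrakk>t \<in> {a..b}; t \<notin> N\<rbrakk> \<Longrightarrow> (f has_vector_derivative g t) (at t within {a..b})"
  shows "(g has_integral (f b - f a)) {a..b}"
proof -
  define g0 where "g0 = (\<lambda>t. if t \<in> N then 0 else g t)"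
  have "(g0 has_integral (f b - f a)) (cbox a b)"
    unfolding has_integral
  proof (intro allI impI)
    fix e :: real
    assume "e > 0"
    define e1 where "e1 = e / (2 * (b - a + 1))"
    have "e1 > 0" using \<open>e > 0\<close> \<open>a \<le> b\<close> by (simp add: e1_def)
    from \<open>e > 0\<close> obtain \<delta> where "\<delta> > 0" and \<delta>: "\<And>D. \<lbrakk>nonoverlapping a b D; (\<Sum>(s, t)\<in>D. t - s) < \<delta>\<rbrakk> \<Longrightarrow>
        (\<Sum>(s, t)\<in>D. norm (f t - f s)) < e / 2"
      using acE[OF ac, of "e / 2"] by auto
    have "\<exists>d>0. x \<in> {a..b} \<and> x \<notin> N \<longrightarrow>
         (\<forall>y\<in>{a..b}. norm (y-x) < d \<longrightarrow> norm (f y - f x - (y-x) *\<^sub>R g x) \<le> e1 * norm (y-x))" for x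
      using der[unfolded has_vector_derivative_def has_derivative_within_alt] \<open>e1 > 0\<close> zero_less_one
      by blast
    then obtain d where d0: "\<And>x. 0 < d x"
      and d: "\<And>x y. \<lbrakk>x \<in> {a..b}; x \<notin> N; y \<in> {a..b}; norm (y-x) < d x\<rbrakk>
                \<Longrightarrow> norm (f y - f x - (y-x) *\<^sub>R g x) \<le> e1 * norm (y-x)"
      by metis
    have "(indicat_real N has_integral 0) (cbox a b)" using N by (simp add: negligible_def)
    from this[unfolded has_integral, rule_format, OF \<open>\<delta> > 0\<close>]
    obtain \<gamma> where "gauge \<gamma>" and \<gamma>: "\<And>p. \<lbrakk>p tagged_division_of cbox a b; \<gamma> fine p\<rbrakk> \<Longrightarrow>
        norm ((\<Sum>(x, K)\<in>p. measure lborel K *\<^sub>R indicat_real N x) - 0) < \<delta>"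
      by auto
    show "\<exists>\<gamma>. gauge \<gamma> \<and> (\<forall>p. p tagged_division_of cbox a b \<and> \<gamma> fine p \<longrightarrow>
        norm ((\<Sum>(x, K)\<in>p. measure lborel K *\<^sub>R g0 x) - (f b - f a)) < e)"
    proof (intro exI[of _ "\<lambda>x. ball x (d x) \<inter> \<gamma> x"] conjI allI impI)
      show "gauge (\<lambda>x. ball x (d x) \<inter> \<gamma> x)"
        using \<open>gauge \<gamma>\<close> d0 by (intro gauge_Int gauge_ball_dependent) auto
    next
      fix p assume "p tagged_division_of cbox a b \<and> (\<lambda>x. ball x (d x) \<inter> \<gamma> x) fine p"
      then have p: "p tagged_division_of cbox a b"
        and fine1: "(\<lambda>x. ball x (d x)) fine p" and fine2: "\<gamma> fine p"
        by (auto simp: fine_Int)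
      have "finite p" using p by blast
      have interval: "\<exists>u v. K = {u..v} \<and> u \<le> x \<and> x \<le> v \<and> a \<le> u \<and> u \<le> v \<and> v \<le> b
          \<and> Inf K = u \<and> Sup K = v \<and> measure lborel K = v - u" if xK: "(x, K) \<in> p" for x K
      proof -
        obtain u v where K: "K = {u..v}"
          using tagged_division_ofD(4)[OF p xK] by auto
        have "x \<in> K" "K \<subseteq> {a..b}"
          using tagged_division_ofD(2,3)[OF p xK] by auto
        then show ?thesis using K by (intro exI[of _ u] exI[of _ v]) auto
      qed
      \<comment> \<open>Degenerate intervals are left out, so that distinct elements of \<open>q\<close> have distinct end points.\<close>
      define q where "q = {(x, K) \<in> p. x \<in> N \<and> Inf K < Sup K}"
      define E where "E = (\<lambda>(x::real, K::real set). (Inf K, Sup K))"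
      have "finite q" using \<open>finite p\<close> by (rule rev_finite_subset) (auto simp: q_def)
      have disj: "{Inf K<..<Sup K} \<inter> {Inf K'<..<Sup K'} = {}"
        if xK: "(x, K) \<in> p" "(x', K') \<in> p" "(x, K) \<noteq> (x', K')" for x K x' K'
      proof -
        obtain u v where uv: "K = {u..v}" "Inf K = u" "Sup K = v" using interval[OF xK(1)] by blast
        obtain u' v' where uv': "K' = {u'..v'}" "Inf K' = u'" "Sup K' = v'"
          using interval[OF xK(2)] by blast
        have "{u<..<v} \<inter> {u'<..<v'} = {}"
          using tagged_division_ofD(5)[OF p xK] unfolding uv(1) uv'(1) interior_atLeastAtMost_real .
        then show ?thesis unfolding uv(2,3) uv'(2,3) .
      qed
      have inj: "inj_on E q"
      proof (rule inj_onI, rule ccontr)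
        fix z z' assume z: "z \<in> q" "z' \<in> q" "E z = E z'" "z \<noteq> z'"
        obtain x K x' K' where "z = (x, K)" "z' = (x', K')" by fastforce
        with z disj[of x K x' K'] show False
          by (auto simp: q_def E_def)
      qed
      have sumq: "(\<Sum>z\<in>q. norm (f (Sup (snd z)) - f (Inf (snd z)))) < e / 2"
      proof -
        have "(\<Sum>(s, t)\<in>E ` q. norm (f t - f s)) < e / 2"
        proof (rule \<delta>)
          have "a \<le> s \<and> s \<le> t \<and> t \<le> b" if st: "(s, t) \<in> E ` q" for s t
          proof -
            obtain x K where "(x, K) \<in> p" "s = Inf K" "t = Sup K"
              using st by (auto simp: E_def q_def)
            then show ?thesis using interval by blast
          qed
          moreover have "pairwise (\<lambda>(s, t) (s', t'). {s<..<t} \<inter> {s'<..<t'} = {}) (E ` q)"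
          proof (rule pairwiseI)
            fix d d' assume "d \<in> E ` q" "d' \<in> E ` q" "d \<noteq> d'"
            then obtain x K x' K' where "(x, K) \<in> p" "(x', K') \<in> p" "(x, K) \<noteq> (x', K')"
              and dd: "d = (Inf K, Sup K)" "d' = (Inf K', Sup K')"
              by (auto simp: E_def q_def)
            then show "(case d of (s, t) \<Rightarrow> \<lambda>(s', t'). {s<..<t} \<inter> {s'<..<t'} = {}) d'"
              using disj[of x K x' K'] unfolding dd by simp
          qed
          ultimately show "nonoverlapping a b (E ` q)"
            using \<open>finite q\<close> unfolding nonoverlapping_def by blast
          have "(\<Sum>(s, t)\<in>E ` q. t - s) = (\<Sum>(x, K)\<in>q. measure lborel K *\<^sub>R indicat_real N x)"
            unfolding sum.reindex[OF inj]
          proof (rule sum.cong)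
            fix z assume "z \<in> q"
            then obtain x K where z: "z = (x, K)" "(x, K) \<in> p" "x \<in> N" by (auto simp: q_def)
            then have "measure lborel K = Sup K - Inf K" using interval by fastforce
            with z show "((\<lambda>(s, t). t - s) \<circ> E) z = (case z of (x, K) \<Rightarrow> measure lborel K *\<^sub>R indicat_real N x)"
              by (simp add: E_def)
          qed simp
          also have "\<dots> \<le> (\<Sum>(x, K)\<in>p. measure lborel K *\<^sub>R indicat_real N x)"
            using \<open>finite p\<close> by (intro sum_mono2) (auto simp: q_def)
          also have "\<dots> < \<delta>" using \<gamma>[OF p fine2] by simp
          finally show "(\<Sum>(s, t)\<in>E ` q. t - s) < \<delta>" .
        qed
        then show ?thesis unfolding sum.reindex[OF inj] by (simp add: E_def split_beta)
      qed
      have "norm ((\<Sum>(x, K)\<in>p. measure lborel K *\<^sub>R g0 x) - (f b - f a)) =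
          norm (\<Sum>(x, K)\<in>p. measure lborel K *\<^sub>R g0 x - (f (Sup K) - f (Inf K)))"
        using additive_tagged_division_1[OF \<open>a \<le> b\<close>, of p f] p
        by (simp add: sum_subtractf split_beta)
      also have "\<dots> \<le> (\<Sum>(x, K)\<in>p. e1 * measure lborel K +
          (if (x, K) \<in> q then norm (f (Sup K) - f (Inf K)) else 0))"
      proof (rule sum_norm_le, clarify)
        fix x K assume xK: "(x, K) \<in> p"
        then obtain u v where uv: "K = {u..v}" "u \<le> x" "x \<le> v" "a \<le> u" "u \<le> v" "v \<le> b"
          "Inf K = u" "Sup K = v" "measure lborel K = v - u" using interval by blast
        show "norm (measure lborel K *\<^sub>R g0 x - (f (Sup K) - f (Inf K))) \<le> e1 * measure lborel K +
          (if (x, K) \<in> q then norm (f (Sup K) - f (Inf K)) else 0)"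
        proof (cases "x \<in> N")
          case True
          then have "(x, K) \<in> q \<or> u = v" using xK uv by (auto simp: q_def)
          then show ?thesis using uv True \<open>e1 > 0\<close> by (auto simp: g0_def norm_minus_commute)
        next
          case False
          have "{u..v} \<subseteq> ball x (d x)" using fine1 xK uv by (auto simp: fine_def)
          moreover have "u \<in> {u..v}" "v \<in> {u..v}" using uv by auto
          ultimately have "u \<in> ball x (d x)" "v \<in> ball x (d x)" by blast+
          then have ux: "norm (u - x) < d x" and vx: "norm (v - x) < d x"
            by (auto simp: dist_real_def)
          have "norm (f u - f x - (u-x) *\<^sub>R g x) \<le> e1 * norm (u-x)"
            by (rule d) (use ux uv False in auto)
          moreover have "norm (f v - f x - (v-x) *\<^sub>R g x) \<le> e1 * norm (v-x)"
            by (rule d) (use vx uv False in auto)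
          moreover have "norm ((v - u) *\<^sub>R g x - (f v - f u)) \<le>
              norm (f u - f x - (u - x) *\<^sub>R g x) + norm (f v - f x - (v - x) *\<^sub>R g x)"
            using norm_triangle_ineq4[of "f u - f x - (u - x) *\<^sub>R g x" "f v - f x - (v - x) *\<^sub>R g x"]
            by (simp add: algebra_simps)
          ultimately have "norm ((v - u) *\<^sub>R g x - (f v - f u)) \<le> e1 * norm (u-x) + e1 * norm (v-x)"
            by linarith
          also have "\<dots> = e1 * (v - u)" using uv by (simp add: algebra_simps)
          finally show ?thesis using uv False by (simp add: g0_def q_def)
        qed
      qed
      also have "\<dots> = e1 * (\<Sum>(x, K)\<in>p. measure lborel K) +
          (\<Sum>z\<in>p. if z \<in> q then norm (f (Sup (snd z)) - f (Inf (snd z))) else 0)"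
        by (simp add: sum.distrib sum_distrib_left split_beta)
      also have "(\<Sum>(x, K)\<in>p. measure lborel K) = b - a"
        using additive_content_tagged_division[OF p] \<open>a \<le> b\<close> by simp
      also have "(\<Sum>z\<in>p. if z \<in> q then norm (f (Sup (snd z)) - f (Inf (snd z))) else 0) =
          (\<Sum>z\<in>q. norm (f (Sup (snd z)) - f (Inf (snd z))))"
        using \<open>finite p\<close> by (intro sum.mono_neutral_cong_right) (auto simp: q_def)
      also have "e1 * (b - a) + (\<Sum>z\<in>q. norm (f (Sup (snd z)) - f (Inf (snd z)))) < e / 2 + e / 2"
        using \<open>e > 0\<close> \<open>a \<le> b\<close> by (intro add_le_less_mono sumq) (simp add: e1_def field_simps)
      finally show "norm ((\<Sum>(x, K)\<in>p. measure lborel K *\<^sub>R g0 x) - (f b - f a)) < e" by simp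
    qed
  qed
  then show ?thesis
    using has_integral_spike[OF N, of "{a..b}" g g0] by (simp add: g0_def)
qed

lemma ac_increment_bound:
  fixes f :: "real \<Rightarrow> 'a::banach"
  assumes "a \<le> b" and ac: "abs_continuous_on_interval a b f" and N: "negligible N"
    and der: "\<And>t. \<lbrakk>t \<in> {a..b}; t \<notin> N\<rbrakk> \<Longrightarrow> (f has_vector_derivative g t) (at t within {a..b})"
    and bnd: "\<And>t. \<lbrakk>t \<in> {a..b}; t \<notin> N\<rbrakk> \<Longrightarrow> norm (g t) \<le> k t"
    and k: "k integrable_on {a..b}"
  shows "norm (f b - f a) \<le> integral {a..b} k"
proof -
  define g0 where "g0 = (\<lambda>t. if t \<in> N then 0 else g t)"
  define k0 where "k0 = (\<lambda>t. if t \<in> N then 0 else k t)"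
  have g0: "(g0 has_integral (f b - f a)) {a..b}"
    by (rule has_integral_spike[OF N _ ac_fundamental_theorem[OF assms(1-4)]]) (auto simp: g0_def)
  have "(k0 has_integral integral {a..b} k) {a..b}"
    by (rule has_integral_spike[OF N _ integrable_integral[OF k]]) (auto simp: k0_def)
  then have "norm (integral {a..b} g0) \<le> integral {a..b} k0"
    using g0 bnd by (intro Henstock_Kurzweil_Integration.integral_norm_bound_integral)
      (auto simp: g0_def k0_def)
  then show ?thesis
    using g0 \<open>(k0 has_integral _) _\<close> by (simp add: integral_unique)
qed


section \<open>Continuously differentiable maps\<close>

lemma C1_compose:
  fixes f :: "'b::real_normed_vector \<Rightarrow> 'c::real_normed_vector"
    and g :: "'a::real_normed_vector \<Rightarrow> 'b"
  assumes "C1 f" "C1 g"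
  shows "C1 (\<lambda>x. f (g x))"
proof -
  obtain f' where f: "\<And>x. (f has_derivative blinfun_apply (f' x)) (at x)"
    and f': "continuous_on UNIV f'" using \<open>C1 f\<close> unfolding C1_def by blast
  obtain g' where g: "\<And>x. (g has_derivative blinfun_apply (g' x)) (at x)"
    and g': "continuous_on UNIV g'" using \<open>C1 g\<close> unfolding C1_def by blast
  have "continuous_on UNIV g"
    using g by (intro continuous_at_imp_continuous_on) (auto intro: has_derivative_continuous)
  then have "continuous_on UNIV (\<lambda>x. f' (g x))"
    by (rule continuous_on_compose2[OF f']) auto
  then have "continuous_on UNIV (\<lambda>x. f' (g x) o\<^sub>L g' x)"
    by (rule bounded_bilinear.continuous_on[OF bounded_bilinear_blinfun_compose _ g'])
  moreover have "((\<lambda>x. f (g x)) has_derivative blinfun_apply (f' (g x) o\<^sub>L g' x)) (at x)" for x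
    using has_derivative_compose[OF g[of x] f[of "g x"]]
    by (simp add: blinfun_compose.rep_eq comp_def)
  ultimately show ?thesis unfolding C1_def by (intro exI[of _ "\<lambda>x. f' (g x) o\<^sub>L g' x"]) blast
qed

lemma C1_fst: "C1 (fst :: 'a::real_normed_vector \<times> 'b::real_normed_vector \<Rightarrow> 'a)"
proof -
  have "(fst has_derivative blinfun_apply fst_blinfun) (at x)" for x :: "'a \<times> 'b"
    unfolding fst_blinfun.rep_eq by (rule bounded_linear_imp_has_derivative[OF bounded_linear_fst])
  then show ?thesis
    unfolding C1_def by (intro exI[of _ "\<lambda>_. fst_blinfun"]) (simp add: continuous_on_const)
qed

lemma C1_Pair:
  fixes f :: "'a::real_normed_vector \<Rightarrow> 'b::real_normed_vector"
    and g :: "'a \<Rightarrow> 'c::real_normed_vector"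
  assumes "C1 f" "C1 g"
  shows "C1 (\<lambda>x. (f x, g x))"
proof -
  obtain f' where f: "\<And>x. (f has_derivative blinfun_apply (f' x)) (at x)"
    and f': "continuous_on UNIV f'" using \<open>C1 f\<close> unfolding C1_def by blast
  obtain g' where g: "\<And>x. (g has_derivative blinfun_apply (g' x)) (at x)"
    and g': "continuous_on UNIV g'" using \<open>C1 g\<close> unfolding C1_def by blast
  define inl :: "'b \<Rightarrow>\<^sub>L ('b \<times> 'c)" where "inl = Blinfun (\<lambda>y. (y, 0))"
  define inr :: "'c \<Rightarrow>\<^sub>L ('b \<times> 'c)" where "inr = Blinfun (\<lambda>y. (0, y))"
  have inl: "blinfun_apply inl y = (y, 0)" for y
    unfolding inl_def by (subst bounded_linear_Blinfun_apply)
      (auto intro!: bounded_linear_Pair bounded_linear_ident bounded_linear_zero)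
  have inr: "blinfun_apply inr y = (0, y)" for y
    unfolding inr_def by (subst bounded_linear_Blinfun_apply)
      (auto intro!: bounded_linear_Pair bounded_linear_ident bounded_linear_zero)
  define D where "D = (\<lambda>x. (inl o\<^sub>L f' x) + (inr o\<^sub>L g' x))"
  have D: "blinfun_apply (D x) = (\<lambda>h. (f' x h, g' x h))" for x
    by (auto simp: D_def fun_eq_iff plus_blinfun.rep_eq inl inr)
  have "continuous_on UNIV D"
    unfolding D_def
    by (intro continuous_on_add bounded_bilinear.continuous_on[OF bounded_bilinear_blinfun_compose]
        continuous_on_const f' g')
  moreover have "((\<lambda>x. (f x, g x)) has_derivative blinfun_apply (D x)) (at x)" for x
    unfolding D by (rule has_derivative_Pair[OF f g])
  ultimately show ?thesis unfolding C1_def by blast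
qed

lemma C1_closed_loop:
  fixes f :: "'x::real_normed_vector \<times> 'g::real_normed_vector \<Rightarrow> 'x"
    and \<phi> :: "'x \<times> 'u::real_normed_vector \<Rightarrow> 'g"
  assumes "C1 f" "C1 \<phi>"
  shows "C1 (\<lambda>z. f (fst z, \<phi> z))"
  by (intro C1_compose[OF assms(1)] C1_Pair C1_fst assms(2))

lemma derivative_bound_on_compact:
  fixes G :: "'a::real_normed_vector \<Rightarrow> 'b::real_normed_vector"
  assumes der: "\<And>z. (G has_derivative blinfun_apply (G' z)) (at z)"
    and cont: "continuous_on UNIV G'" and K: "compact K" "convex K"
  obtains L where "L \<ge> 0" "\<And>z. z \<in> K \<Longrightarrow> norm (G' z) \<le> L"
    "\<And>z z'. \<lbrakk>z \<in> K; z' \<in> K\<rbrakk> \<Longrightarrow> norm (G z' - G z) \<le> L * norm (z' - z)"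
proof -
  have "bounded (G' ` K)"
    using cont K by (intro compact_imp_bounded compact_continuous_image)
      (auto intro: continuous_on_subset)
  then obtain B where B: "\<And>z. z \<in> K \<Longrightarrow> norm (G' z) \<le> B" by (auto simp: bounded_iff)
  have "norm (G z' - G z) \<le> max B 0 * norm (z' - z)" if "z \<in> K" "z' \<in> K" for z z'
  proof (rule differentiable_bound[OF K(2)])
    show "(G has_derivative blinfun_apply (G' w)) (at w within K)" for w
      using der has_derivative_at_withinI by blast
    show "onorm (blinfun_apply (G' w)) \<le> max B 0" if "w \<in> K" for w
      using B[OF that] by (simp add: norm_blinfun.rep_eq[symmetric])
  qed (use that in auto)
  then show ?thesis using B by (intro that[of "max B 0"]) (auto simp: le_max_iff_disj)
qed

text \<open>A Taylor estimate in which the increment need not be small: on a compact convex set the first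
  order remainder is small to first order up to a quadratic term.  Increments below the modulus of
  uniform continuity of the derivative account for the linear term, the others for the quadratic
  one.\<close>

lemma taylor_remainder_on_compact:
  fixes G :: "'a::real_normed_vector \<Rightarrow> 'b::real_normed_vector"
  assumes der: "\<And>z. (G has_derivative blinfun_apply (G' z)) (at z)"
    and cont: "continuous_on UNIV G'" and K: "compact K" "convex K" and "e > 0"
  obtains C where "C \<ge> 0" "\<And>z z'. \<lbrakk>z \<in> K; z' \<in> K\<rbrakk> \<Longrightarrow>
    norm (G z' - G z - G' z (z' - z)) \<le> e * norm (z' - z) + C * (norm (z' - z))\<^sup>2"
proof -
  obtain L where L: "L \<ge> 0" "\<And>z. z \<in> K \<Longrightarrow> norm (G' z) \<le> L"
    "\<And>z z'. \<lbrakk>z \<in> K; z' \<in> K\<rbrakk> \<Longrightarrow> norm (G z' - G z) \<le> L * norm (z' - z)"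
    using derivative_bound_on_compact[OF der cont K] by blast
  have "uniformly_continuous_on K G'"
    using cont K by (intro compact_uniformly_continuous) (auto intro: continuous_on_subset)
  then obtain \<eta> where "\<eta> > 0"
    and \<eta>: "\<And>z z'. \<lbrakk>z \<in> K; z' \<in> K; dist z' z < \<eta>\<rbrakk> \<Longrightarrow> dist (G' z') (G' z) < e"
    using \<open>e > 0\<close> unfolding uniformly_continuous_on_def by meson
  have "norm (G z' - G z - G' z (z' - z)) \<le> e * norm (z' - z) + (2 * L / \<eta>) * (norm (z' - z))\<^sup>2"
    if zK: "z \<in> K" "z' \<in> K" for z z'
  proof (cases "norm (z' - z) < \<eta>")
    case True
    have seg: "closed_segment z z' \<subseteq> K" using zK K(2) by (rule closed_segment_subset)
    have "norm (G z' - G z - G' z (z' - z)) \<le> norm (z' - z) * e"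
    proof (rule differentiable_bound_linearization[where S = "closed_segment z z'"])
      show "z + t *\<^sub>R (z' - z) \<in> closed_segment z z'" if "t \<in> {0..1}" for t
        using that unfolding in_segment by (intro exI[of _ t]) (auto simp: algebra_simps)
      show "(G has_derivative blinfun_apply (G' w)) (at w within closed_segment z z')" for w
        using der has_derivative_at_withinI by blast
      show "onorm (blinfun_apply (G' w) - blinfun_apply (G' z)) \<le> e"
        if w: "w \<in> closed_segment z z'" for w
      proof -
        have "dist w z < \<eta>"
          using segment_bound(1)[OF w] True by (simp add: dist_norm)
        then have "norm (G' w - G' z) \<le> e"
          using \<eta>[of z w] w seg zK by (auto simp: dist_norm intro: less_imp_le)
        then show ?thesis
          by (simp add: norm_blinfun.rep_eq minus_blinfun.rep_eq fun_diff_def)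
      qed
    qed auto
    moreover have "0 \<le> (2 * L / \<eta>) * (norm (z' - z))\<^sup>2" using L(1) \<open>\<eta> > 0\<close> by simp
    ultimately show ?thesis by (simp add: mult.commute)
  next
    case False
    have "norm (G z' - G z - G' z (z' - z)) \<le> norm (G z' - G z) + norm (G' z (z' - z))"
      by (rule norm_triangle_ineq4)
    also have "norm (G' z (z' - z)) \<le> L * norm (z' - z)"
      by (rule order_trans[OF norm_blinfun mult_right_mono]) (use L(2) zK in auto)
    also have "norm (G z' - G z) \<le> L * norm (z' - z)" using L(3) zK by blast
    also have "L * norm (z' - z) + L * norm (z' - z) = (2 * L / \<eta>) * (\<eta> * norm (z' - z))"
      using \<open>\<eta> > 0\<close> by simp
    also have "\<dots> \<le> (2 * L / \<eta>) * (norm (z' - z))\<^sup>2"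
      using False L(1) \<open>\<eta> > 0\<close> unfolding power2_eq_square
      by (intro mult_left_mono mult_right_mono) auto
    also have "\<dots> \<le> e * norm (z' - z) + (2 * L / \<eta>) * (norm (z' - z))\<^sup>2" using \<open>e > 0\<close> by simp
    finally show ?thesis by simp
  qed
  then show ?thesis using L(1) \<open>\<eta> > 0\<close> by (intro that[of "2 * L / \<eta>"]) auto
qed


section \<open>Square integrable functions on an interval\<close>

lemma AE_lebesgue_on_IccE:
  assumes "AE t in lebesgue_on {a..b::real}. P t"
  obtains N where "negligible N" "\<And>t. \<lbrakk>t \<in> {a..b}; t \<notin> N\<rbrakk> \<Longrightarrow> P t"
proof -
  have "AE t in lebesgue. t \<in> {a..b} \<longrightarrow> P t"
    using assms by (subst (asm) AE_restrict_space_iff) auto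
  then obtain N where "N \<in> null_sets lebesgue" "{t. \<not> (t \<in> {a..b} \<longrightarrow> P t)} \<subseteq> N"
    by (auto simp: eventually_ae_filter)
  then show ?thesis
    by (intro that[of N]) (auto simp: negligible_iff_null_sets)
qed

lemma AE_lebesgue_on_IccI:
  assumes "negligible N" "\<And>t. \<lbrakk>t \<in> {a..b::real}; t \<notin> N\<rbrakk> \<Longrightarrow> P t"
  shows "AE t in lebesgue_on {a..b}. P t"
proof -
  have "AE t in lebesgue. t \<in> {a..b} \<longrightarrow> P t"
    using assms by (intro AE_I'[of N]) (auto simp: negligible_iff_null_sets)
  then show ?thesis by (subst AE_restrict_space_iff) auto
qed

lemma integrable_lebesgue_on_Icc_bounded:
  fixes f :: "real \<Rightarrow> 'a::euclidean_space"
  assumes "f \<in> borel_measurable (lebesgue_on {a..b})" "AE t in lebesgue_on {a..b}. norm (f t) \<le> B"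
  shows "integrable (lebesgue_on {a..b}) f"
  by (rule finite_measure.integrable_const_bound[OF finite_measure_lebesgue_on assms(2,1)]) simp

lemma measurable_lebesgue_on_AE:
  fixes f g :: "real \<Rightarrow> 'a::euclidean_space"
  assumes f: "f \<in> borel_measurable (lebesgue_on {a..b})" and "AE t in lebesgue_on {a..b}. f t = g t"
  shows "g \<in> borel_measurable (lebesgue_on {a..b})"
proof -
  let ?c = "\<lambda>f t. if t \<in> {a..b} then f t else (0::'a)"
  have "AE t in lebesgue. t \<in> {a..b} \<longrightarrow> f t = g t"
    using assms(2) by (subst (asm) AE_restrict_space_iff) auto
  then have "AE t in lebesgue. ?c f t = ?c g t" by (rule eventually_mono) auto
  moreover have "?c f \<in> borel_measurable lebesgue"
    using f by (subst borel_measurable_if) auto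
  ultimately have "?c g \<in> borel_measurable lebesgue" by (rule borel_measurable_AE[rotated])
  then show ?thesis by (subst (asm) borel_measurable_if) auto
qed

lemma L2_bounded:
  fixes f :: "real \<Rightarrow> 'a::euclidean_space"
  assumes "f \<in> borel_measurable (lebesgue_on {0..T})" "AE t in lebesgue_on {0..T}. norm (f t) \<le> B"
  shows "f \<in> L2 T"
proof -
  have "AE t in lebesgue_on {0..T}. norm ((norm (f t))\<^sup>2) \<le> B\<^sup>2"
    using assms(2) by (rule eventually_mono) (auto intro: power_mono)
  then have "integrable (lebesgue_on {0..T}) (\<lambda>t. (norm (f t))\<^sup>2)"
    using assms(1) by (intro integrable_lebesgue_on_Icc_bounded[where B = "B\<^sup>2"]) auto
  then show ?thesis using assms(1) by (simp add: L2_def)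
qed

lemma norm_L2_nonneg: "norm_L2 T f \<ge> 0"
  by (simp add: norm_L2_def)

lemma norm_L2_power2: "(norm_L2 T f)\<^sup>2 = (LINT t|lebesgue_on {0..T}. (norm (f t))\<^sup>2)"
  by (simp add: norm_L2_def)

lemma integrable_L2:
  fixes f :: "real \<Rightarrow> 'a::euclidean_space"
  assumes "f \<in> L2 T"
  shows "integrable (lebesgue_on {0..T}) f"
proof (rule Bochner_Integration.integrable_bound)
  show "integrable (lebesgue_on {0..T}) (\<lambda>t. 1 + (norm (f t))\<^sup>2)"
    using assms by (auto simp: L2_def)
  show "AE t in lebesgue_on {0..T}. norm (f t) \<le> norm (1 + (norm (f t))\<^sup>2)"
  proof (rule AE_I2)
    fix t
    have "0 \<le> (norm (f t) - 1)\<^sup>2" by simp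
    then have "2 * norm (f t) \<le> 1 + (norm (f t))\<^sup>2" by (simp add: power2_diff)
    then show "norm (f t) \<le> norm (1 + (norm (f t))\<^sup>2)"
      using norm_ge_zero[of "f t"] unfolding real_norm_def by linarith
  qed
qed (use assms in \<open>simp add: L2_def\<close>)

text \<open>The constant is not optimal; it comes from integrating \<open>\<bar>f\<bar> \<le> \<bar>f\<bar>\<^sup>2 / s + s\<close> with
  \<open>s = \<parallel>f\<parallel>\<close>, or with \<open>s\<close> tending to \<open>0\<close> if \<open>\<parallel>f\<parallel> = 0\<close>.\<close>

lemma integral_norm_le_norm_L2:
  fixes f :: "real \<Rightarrow> 'a::euclidean_space"
  assumes f: "f \<in> L2 T" and "T > 0"
  shows "(LINT t|lebesgue_on {0..T}. norm (f t)) \<le> (1 + T) * norm_L2 T f"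
proof -
  define n where "n = norm_L2 T f"
  have n: "n \<ge> 0" "n\<^sup>2 = (LINT t|lebesgue_on {0..T}. (norm (f t))\<^sup>2)"
    by (simp_all add: n_def norm_L2_nonneg norm_L2_power2)
  have le: "(LINT t|lebesgue_on {0..T}. norm (f t)) \<le> n\<^sup>2 / s + s * T" if "s > 0" for s
  proof -
    have pw: "norm (f t) \<le> (norm (f t))\<^sup>2 / s + s" for t
    proof (cases "norm (f t) \<le> s")
      case True
      moreover have "0 \<le> (norm (f t))\<^sup>2 / s" using \<open>s > 0\<close> by simp
      ultimately show ?thesis by linarith
    next
      case False
      then have "norm (f t) * s \<le> norm (f t) * norm (f t)" by (intro mult_left_mono) auto
      then have "norm (f t) \<le> (norm (f t))\<^sup>2 / s"
        using \<open>s > 0\<close> by (simp add: field_simps power2_eq_square)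
      then show ?thesis using \<open>s > 0\<close> by linarith
    qed
    have "(LINT t|lebesgue_on {0..T}. norm (f t)) \<le>
        (LINT t|lebesgue_on {0..T}. (norm (f t))\<^sup>2 / s + s)"
      using f integrable_norm[OF integrable_L2[OF f]] pw by (intro integral_mono) (auto simp: L2_def)
    also have "\<dots> = n\<^sup>2 / s + s * T"
      using f \<open>T > 0\<close> n(2) by (subst Bochner_Integration.integral_add)
        (auto simp: L2_def measure_restrict_space)
    finally show ?thesis .
  qed
  show ?thesis
  proof (cases "n = 0")
    case True
    have "(LINT t|lebesgue_on {0..T}. norm (f t)) \<le> 0"
    proof (rule field_le_epsilon)
      fix e :: real assume "e > 0"
      then show "(LINT t|lebesgue_on {0..T}. norm (f t)) \<le> 0 + e"
        using le[of "e / T"] True \<open>T > 0\<close> by simp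
    qed
    then show ?thesis using True by (simp add: n_def)
  next
    case False
    then have "(LINT t|lebesgue_on {0..T}. norm (f t)) \<le> n\<^sup>2 / n + n * T"
      using n(1) by (intro le) auto
    then show ?thesis using False by (simp add: n_def power2_eq_square algebra_simps)
  qed
qed


section \<open>Dependence of trajectories on the input\<close>

lemma gronwall:
  fixes y :: "real \<Rightarrow> real"
  assumes cont: "continuous_on {0..T} y" and "L \<ge> 0"
    and le: "\<And>t. t \<in> {0..T} \<Longrightarrow> y t \<le> A + L * integral {0..t} y"
    and t: "t \<in> {0..T}"
  shows "y t \<le> A * exp (L * t)"
proof -
  define Z where "Z = (\<lambda>t. A + L * integral {0..t} y)"
  define W where "W = (\<lambda>t. exp (- L * t) * Z t)"
  have Z: "(Z has_real_derivative L * y s) (at s within {0..T})" if "s \<in> {0..T}" for s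
    unfolding Z_def using integral_has_real_derivative[OF cont that]
    by (auto intro!: derivative_eq_intros)
  have W: "(W has_real_derivative exp (- L * s) * (L * (y s - Z s))) (at s within {0..T})"
    if "s \<in> {0..T}" for s
    unfolding W_def using Z[OF that] by (auto intro!: derivative_eq_intros simp: algebra_simps)
  have "W t \<le> W 0"
  proof (cases "t = 0")
    case False
    have "continuous_on {0..T} W"
      using W by (meson DERIV_continuous continuous_on_eq_continuous_within)
    then have contt: "continuous_on {0..t} W" using t by (auto elim: continuous_on_subset)
    show ?thesis
    proof (rule DERIV_nonpos_imp_decreasing_open[OF _ _ contt])
      fix s assume s: "0 < s" "s < t"
      then have "(W has_real_derivative exp (- L * s) * (L * (y s - Z s))) (at s)"
        using W[of s] t by (simp add: at_within_Icc_at)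
      moreover have "exp (- L * s) * (L * (y s - Z s)) \<le> 0"
        using le[of s] s t \<open>L \<ge> 0\<close>
        by (auto simp: Z_def mult_le_0_iff intro!: mult_nonneg_nonpos)
      ultimately show "\<exists>d. (W has_real_derivative d) (at s) \<and> d \<le> 0" by blast
    qed (use False t in auto)
  qed simp
  then have "exp (- L * t) * Z t \<le> A" by (simp add: W_def Z_def)
  then have le_A: "exp (L * t) * (exp (- L * t) * Z t) \<le> exp (L * t) * A" by (intro mult_left_mono) auto
  have "exp (L * t) * (exp (- L * t) * Z t) = Z t"
    by (simp add: exp_minus)
  with le_A have "Z t \<le> A * exp (L * t)" by (metis mult.commute)
  then show ?thesis using le[OF t] unfolding Z_def by linarith
qed

text \<open>Absolutely continuous solutions of \<open>y' = G(y,v)\<close> on \<open>[0,T]\<close>.\<close>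

definition solves_ode :: "('x::real_normed_vector \<times> 'u \<Rightarrow> 'x) \<Rightarrow> real \<Rightarrow> (real \<Rightarrow> 'u) \<Rightarrow> (real \<Rightarrow> 'x) \<Rightarrow> bool"
  where "solves_ode G T v y \<longleftrightarrow> abs_continuous_on_interval 0 T y \<and>
    (AE t in lebesgue_on {0..T}. (y has_vector_derivative G (y t, v t)) (at t))"

text \<open>Trajectories depend Lipschitz continuously on the input, from \<open>L\<^sup>1\<close> to the supremum norm.  The
  Lipschitz constant of \<open>G\<close> is only available near the reference trajectory, so the estimate is
  restricted to inputs close enough to keep the trajectory within distance \<open>1\<close> of it.\<close>

lemma trajectory_stability:
  fixes G :: "'x::euclidean_space \<times> 'u::euclidean_space \<Rightarrow> 'x"
  assumes der: "\<And>z. (G has_derivative blinfun_apply (G' z)) (at z)"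
    and cont: "continuous_on UNIV G'" and "T > 0"
    and x: "solves_ode G T u x"
    and u: "u \<in> borel_measurable (lebesgue_on {0..T})" "AE t in lebesgue_on {0..T}. norm (u t) \<le> B"
  obtains C where "C \<ge> 0"
    "\<And>v y t. \<lbrakk>solves_ode G T v y; y 0 = x 0; v \<in> borel_measurable (lebesgue_on {0..T});
        AE t in lebesgue_on {0..T}. norm (v t) \<le> B;
        C * (LINT t|lebesgue_on {0..T}. norm (v t - u t)) < 1; t \<in> {0..T}\<rbrakk> \<Longrightarrow>
      norm (y t - x t) \<le> C * (LINT t|lebesgue_on {0..T}. norm (v t - u t))"
proof -
  have xac: "abs_continuous_on_interval 0 T x"
    and xder: "AE t in lebesgue_on {0..T}. (x has_vector_derivative G (x t, u t)) (at t)"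
    using x unfolding solves_ode_def by auto
  obtain Bx where Bx: "\<And>t. t \<in> {0..T} \<Longrightarrow> norm (x t) \<le> Bx" using ac_bounded[OF xac] by blast
  define K where "K = cball (0::'x) (Bx + 1) \<times> cball (0::'u) B"
  have K: "compact K" "convex K" by (auto simp: K_def compact_Times convex_Times)
  obtain L where L: "L \<ge> 0"
    "\<And>z z'. \<lbrakk>z \<in> K; z' \<in> K\<rbrakk> \<Longrightarrow> norm (G z' - G z) \<le> L * norm (z' - z)"
    using derivative_bound_on_compact[OF der cont K] by metis
  define C where "C = L * exp (L * T)"
  have "C \<ge> 0" using L(1) by (simp add: C_def)
  moreover have "norm (y t - x t) \<le> C * (LINT t|lebesgue_on {0..T}. norm (v t - u t))"
    if y: "solves_ode G T v y" and y0: "y 0 = x 0"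
      and v: "v \<in> borel_measurable (lebesgue_on {0..T})" "AE t in lebesgue_on {0..T}. norm (v t) \<le> B"
      and small: "C * (LINT t|lebesgue_on {0..T}. norm (v t - u t)) < 1" and tT: "t \<in> {0..T}"
    for v y t
  proof -
    define h where "h = (\<lambda>t. norm (v t - u t))"
    define I where "I = (LINT t|lebesgue_on {0..T}. h t)"
    define \<delta> where "\<delta> = (\<lambda>t. y t - x t)"
    have yac: "abs_continuous_on_interval 0 T y"
      and yder: "AE t in lebesgue_on {0..T}. (y has_vector_derivative G (y t, v t)) (at t)"
      using y unfolding solves_ode_def by auto
    have \<delta>ac: "abs_continuous_on_interval 0 T \<delta>" unfolding \<delta>_def by (rule ac_diff[OF yac xac])
    have \<delta>cont: "continuous_on {0..T} \<delta>" by (rule ac_continuous_on[OF \<delta>ac])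
    have "AE t in lebesgue_on {0..T}. norm (h t) \<le> 2 * B"
      using u(2) v(2)
    proof eventually_elim
      case (elim t)
      then show ?case using norm_triangle_ineq4[of "v t" "u t"] by (simp add: h_def)
    qed
    then have "integrable (lebesgue_on {0..T}) h"
      using u(1) v(1) by (intro integrable_lebesgue_on_Icc_bounded) (auto simp: h_def)
    then have hI: "(h has_integral I) {0..T}"
      unfolding I_def by (intro has_integral_integral_lebesgue_on) auto
    have "AE t in lebesgue_on {0..T}. (\<delta> has_vector_derivative G (y t, v t) - G (x t, u t)) (at t)
        \<and> norm (u t) \<le> B \<and> norm (v t) \<le> B"
      using xder yder u(2) v(2)
      by eventually_elim (auto simp: \<delta>_def intro: has_vector_derivative_diff)
    then obtain N where N: "negligible N" and Nder: "\<And>t. \<lbrakk>t \<in> {0..T}; t \<notin> N\<rbrakk> \<Longrightarrow>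
        (\<delta> has_vector_derivative G (y t, v t) - G (x t, u t)) (at t) \<and> norm (u t) \<le> B \<and> norm (v t) \<le> B"
      by (rule AE_lebesgue_on_IccE) blast
    have est: "norm (\<delta> s) \<le> C * I"
      if s: "s \<in> {0..T}" and le1: "\<And>r. r \<in> {0..s} \<Longrightarrow> norm (\<delta> r) \<le> 1" for s
    proof -
      have c: "continuous_on {0..s} (\<lambda>r. norm (\<delta> r))"
        using \<delta>cont s by (intro continuous_on_norm) (auto elim: continuous_on_subset)
      have "norm (\<delta> s) \<le> L * I * exp (L * s)"
      proof (rule gronwall[OF c L(1)])
        fix t assume t: "t \<in> {0..s}"
        have ct: "(\<lambda>r. norm (\<delta> r)) integrable_on {0..t}"
          using c t by (intro integrable_continuous_real) (auto elim: continuous_on_subset)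
        have ht: "h integrable_on {0..t}"
          using s t by (intro integrable_on_subinterval[OF has_integral_integrable[OF hI]]) auto
        have k: "(\<lambda>r. L * (norm (\<delta> r) + h r)) integrable_on {0..t}"
          by (intro integrable_on_mult_right integrable_add ct ht)
        have "norm (\<delta> t - \<delta> 0) \<le> integral {0..t} (\<lambda>r. L * (norm (\<delta> r) + h r))"
        proof (rule ac_increment_bound[OF _ ac_subinterval[OF \<delta>ac] N _ _ k])
          fix r assume r: "r \<in> {0..t}" "r \<notin> N"
          then have rT: "r \<in> {0..T}" "r \<in> {0..s}" using s t by auto
          show "(\<delta> has_vector_derivative G (y r, v r) - G (x r, u r)) (at r within {0..t})"
            using Nder[OF rT(1) r(2)] has_vector_derivative_at_within by blast
          have "norm (y r) \<le> norm (x r) + norm (\<delta> r)"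
            using norm_triangle_ineq[of "x r" "\<delta> r"] by (simp add: \<delta>_def)
          then have "(y r, v r) \<in> K" "(x r, u r) \<in> K"
            using Bx[OF rT(1)] le1[OF rT(2)] Nder[OF rT(1) r(2)] by (auto simp: K_def)
          then have "norm (G (y r, v r) - G (x r, u r)) \<le> L * norm ((y r, v r) - (x r, u r))"
            by (intro L(2))
          also have "\<dots> \<le> L * (norm (\<delta> r) + h r)"
            using L(1) norm_Pair_le[of "y r - x r" "v r - u r"]
            by (intro mult_left_mono) (auto simp: \<delta>_def h_def)
          finally show "norm (G (y r, v r) - G (x r, u r)) \<le> L * (norm (\<delta> r) + h r)" .
        qed (use s t in auto)
        also have "\<dots> = L * integral {0..t} (\<lambda>r. norm (\<delta> r)) + L * integral {0..t} h"
          by (simp only: integral_mult_right integral_add[OF ct ht]) (simp only: distrib_left)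
        finally have le: "norm (\<delta> t - \<delta> 0) \<le> L * integral {0..t} (\<lambda>r. norm (\<delta> r)) + L * integral {0..t} h" .
        have "integral {0..t} h \<le> integral {0..T} h"
          using s t by (intro integral_subset_le ht has_integral_integrable[OF hI]) (auto simp: h_def)
        then have "L * integral {0..t} h \<le> L * I"
          using L(1) by (simp add: integral_unique[OF hI] mult_left_mono)
        then show "norm (\<delta> t) \<le> L * I + L * integral {0..t} (\<lambda>r. norm (\<delta> r))"
          using le y0 by (simp add: \<delta>_def)
      qed (use s in auto)
      also have "\<dots> \<le> L * I * exp (L * T)"
      proof (rule mult_left_mono)
        have "I \<ge> 0" unfolding I_def h_def by (simp add: integral_nonneg_AE)
        then show "0 \<le> L * I" using L(1) by simp
        show "exp (L * s) \<le> exp (L * T)" using s L(1) by (simp add: mult_left_mono)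
      qed
      finally show ?thesis by (simp add: C_def mult_ac)
    qed
    have small: "C * I < 1" using small by (simp add: I_def h_def)
    \<comment> \<open>At the first time when the deviation equals 1 the estimate above would force it below 1.\<close>
    have le1: "norm (\<delta> s) \<le> 1" if s: "s \<in> {0..T}" for s
    proof (rule ccontr)
      assume "\<not> norm (\<delta> s) \<le> 1"
      define Z where "Z = {r \<in> {0..T}. norm (\<delta> r) = 1}"
      have first: "\<exists>r\<in>Z. r \<le> s'" if s': "s' \<in> {0..T}" "norm (\<delta> s') > 1" for s'
      proof -
        have "continuous_on {0..s'} (\<lambda>r. norm (\<delta> r))"
          using \<delta>cont s' by (intro continuous_on_norm) (auto elim: continuous_on_subset)
        then have "\<exists>r. 0 \<le> r \<and> r \<le> s' \<and> norm (\<delta> r) = 1"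
          using s' y0 by (intro IVT') (auto simp: \<delta>_def)
        then show ?thesis using s' by (auto simp: Z_def)
      qed
      have "Z \<noteq> {}" using first[OF s] \<open>\<not> _\<close> by auto
      moreover have "compact Z"
      proof -
        have "closed Z"
          unfolding Z_def using \<delta>cont
          by (intro continuous_closed_preimage_constant continuous_on_norm) auto
        then have "compact ({0..T} \<inter> Z)" by (intro compact_Int_closed) auto
        moreover have "{0..T} \<inter> Z = Z" by (auto simp: Z_def)
        ultimately show ?thesis by simp
      qed
      ultimately obtain r where r: "r \<in> Z" "\<And>r'. r' \<in> Z \<Longrightarrow> r \<le> r'"
        using compact_attains_inf by metis
      have "norm (\<delta> r) \<le> C * I"
      proof (rule est)
        fix r' assume r': "r' \<in> {0..r}"
        show "norm (\<delta> r') \<le> 1"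
        proof (rule ccontr)
          assume "\<not> norm (\<delta> r') \<le> 1"
          then obtain r'' where "r'' \<in> Z" "r'' \<le> r'"
            using first[of r'] r' r(1) by (auto simp: Z_def)
          then have "r' = r" using r(2)[of r''] r' by auto
          then show False using \<open>\<not> norm (\<delta> r') \<le> 1\<close> r(1) by (simp add: Z_def)
        qed
      qed (use r in \<open>auto simp: Z_def\<close>)
      then show False using r(1) small by (simp add: Z_def)
    qed
    have "norm (\<delta> t) \<le> C * I" using tT by (intro est le1) auto
    then show ?thesis by (simp add: \<delta>_def I_def h_def)
  qed
  ultimately show ?thesis by (rule that)
qed


section \<open>Expansion of the terminal value by the costate\<close>

lemma ac_measurable:
  fixes f :: "real \<Rightarrow> 'a::euclidean_space"
  assumes "abs_continuous_on_interval a b f"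
  shows "f \<in> borel_measurable (lebesgue_on {a..b})"
  by (intro continuous_imp_measurable_on_sets_lebesgue ac_continuous_on[OF assms]) auto

lemma measurable_derivative_along:
  fixes G' :: "'x::euclidean_space \<times> 'u::euclidean_space \<Rightarrow> ('x \<times> 'u) \<Rightarrow>\<^sub>L 'x"
  assumes cont: "continuous_on UNIV G'"
    and [measurable]: "x \<in> borel_measurable M" "u \<in> borel_measurable M" "p \<in> borel_measurable M"
      "h \<in> borel_measurable M"
  shows "(\<lambda>t. p t \<bullet> G' (x t, u t) (0, h t)) \<in> borel_measurable M"
proof -
  have "continuous_on UNIV (\<lambda>w :: 'x \<times> ('x \<times> 'u) \<times> 'u. fst w \<bullet> G' (fst (snd w)) (0, snd (snd w)))"
    by (intro continuous_intros continuous_on_compose2[OF cont]) auto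
  then have "(\<lambda>w :: 'x \<times> ('x \<times> 'u) \<times> 'u. fst w \<bullet> G' (fst (snd w)) (0, snd (snd w))) \<in> borel_measurable borel"
    by (rule borel_measurable_continuous_onI)
  moreover have "(\<lambda>t. (p t, (x t, u t), h t)) \<in> borel_measurable M"
    by measurable
  ultimately have "(\<lambda>w. fst w \<bullet> G' (fst (snd w)) (0, snd (snd w))) \<circ> (\<lambda>t. (p t, (x t, u t), h t))
      \<in> borel_measurable M"
    by (rule measurable_comp[rotated])
  then show ?thesis by (simp add: comp_def)
qed

text \<open>The hypothesis on \<open>p\<close> is the adjoint equation \<open>p' = - \<partial>\<^sub>xG(x,u)\<^sup>T p\<close>.  Under it the first
  order change of the terminal value \<open>p(T) \<bullet> x(T)\<close> caused by a
  change \<open>h\<close> of the input is \<open>\<integral> p \<bullet> \<partial>\<^sub>uG(x,u) h\<close>, with an error that is \<open>o(\<parallel>h\<parallel>)\<close> in the \<open>L\<^sup>2\<close> norm.\<close>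

lemma terminal_value_expansion:
  fixes G :: "'x::euclidean_space \<times> 'u::euclidean_space \<Rightarrow> 'x"
  assumes der: "\<And>z. (G has_derivative blinfun_apply (G' z)) (at z)"
    and cont: "continuous_on UNIV G'" and "T > 0"
    and x: "solves_ode G T u x"
    and u: "u \<in> borel_measurable (lebesgue_on {0..T})" "AE t in lebesgue_on {0..T}. norm (u t) \<le> B"
    and pac: "abs_continuous_on_interval 0 T p"
    and pder: "AE t in lebesgue_on {0..T}. \<exists>q. (p has_vector_derivative q) (at t) \<and>
        (\<forall>w. q \<bullet> w = - (p t \<bullet> G' (x t, u t) (w, 0)))"
    and "e > 0"
  obtains d where "d > 0"
    "\<And>v y. \<lbrakk>solves_ode G T v y; y 0 = x 0; v \<in> borel_measurable (lebesgue_on {0..T});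
        AE t in lebesgue_on {0..T}. norm (v t) \<le> B; norm_L2 T (\<lambda>t. v t - u t) < d\<rbrakk> \<Longrightarrow>
      \<bar>p T \<bullet> y T - p T \<bullet> x T
        - (LINT t|lebesgue_on {0..T}. p t \<bullet> G' (x t, u t) (0, v t - u t))\<bar>
      \<le> e * norm_L2 T (\<lambda>t. v t - u t)"
proof -
  have xac: "abs_continuous_on_interval 0 T x"
    and xder: "AE t in lebesgue_on {0..T}. (x has_vector_derivative G (x t, u t)) (at t)"
    using x unfolding solves_ode_def by auto
  obtain Bx where Bx: "\<And>t. t \<in> {0..T} \<Longrightarrow> norm (x t) \<le> Bx" using ac_bounded[OF xac] by blast
  obtain P where P: "P \<ge> 0" "\<And>t. t \<in> {0..T} \<Longrightarrow> norm (p t) \<le> P" using ac_bounded[OF pac] by blast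
  obtain D where D: "D \<ge> 0"
    "\<And>v y t. \<lbrakk>solves_ode G T v y; y 0 = x 0; v \<in> borel_measurable (lebesgue_on {0..T});
        AE t in lebesgue_on {0..T}. norm (v t) \<le> B;
        D * (LINT t|lebesgue_on {0..T}. norm (v t - u t)) < 1; t \<in> {0..T}\<rbrakk> \<Longrightarrow>
      norm (y t - x t) \<le> D * (LINT t|lebesgue_on {0..T}. norm (v t - u t))"
    using trajectory_stability[OF der cont \<open>T > 0\<close> x u] by blast
  define K where "K = cball (0::'x) (Bx + 1) \<times> cball (0::'u) B"
  have K: "compact K" "convex K" by (auto simp: K_def compact_Times convex_Times)
  obtain L where L: "L \<ge> 0" "\<And>z. z \<in> K \<Longrightarrow> norm (G' z) \<le> L"
    using derivative_bound_on_compact[OF der cont K] by metis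
  define D1 where "D1 = D * (1 + T)"
  have "D1 \<ge> 0" using D(1) \<open>T > 0\<close> by (simp add: D1_def)
  define a where "a = P * (D1 * T + (1 + T))"
  have "a \<ge> 0" using P(1) \<open>T > 0\<close> \<open>D1 \<ge> 0\<close> by (simp add: a_def)
  define e1 where "e1 = e / (2 * (a + 1))"
  have "e1 > 0" using \<open>e > 0\<close> \<open>a \<ge> 0\<close> by (simp add: e1_def)
  have e1: "e1 * a \<le> e / 2"
    using \<open>e > 0\<close> \<open>a \<ge> 0\<close> by (simp add: e1_def field_simps)
  obtain C where C: "C \<ge> 0" "\<And>z z'. \<lbrakk>z \<in> K; z' \<in> K\<rbrakk> \<Longrightarrow>
      norm (G z' - G z - G' z (z' - z)) \<le> e1 * norm (z' - z) + C * (norm (z' - z))\<^sup>2"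
    using taylor_remainder_on_compact[OF der cont K \<open>e1 > 0\<close>] by blast
  define b where "b = P * (2 * C * (D1\<^sup>2 * T + 1))"
  have "b \<ge> 0" using P(1) C(1) \<open>T > 0\<close> by (simp add: b_def)
  \<comment> \<open>With \<open>n = \<parallel>v - u\<parallel>\<close>, the remainder will be at most \<open>e1 * a * n + b * n\<^sup>2\<close>; the other bound on
    \<open>n\<close> keeps the trajectory within distance \<open>1\<close> of \<open>x\<close>.\<close>
  define d where "d = min (1 / (D1 + 1)) (e / (2 * (b + 1)))"
  have "d > 0" using \<open>e > 0\<close> \<open>b \<ge> 0\<close> \<open>D1 \<ge> 0\<close> by (simp add: d_def)
  moreover have "\<bar>p T \<bullet> y T - p T \<bullet> x T
        - (LINT t|lebesgue_on {0..T}. p t \<bullet> G' (x t, u t) (0, v t - u t))\<bar>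
      \<le> e * norm_L2 T (\<lambda>t. v t - u t)"
    if y: "solves_ode G T v y" and y0: "y 0 = x 0"
      and v: "v \<in> borel_measurable (lebesgue_on {0..T})" "AE t in lebesgue_on {0..T}. norm (v t) \<le> B"
      and small: "norm_L2 T (\<lambda>t. v t - u t) < d" for v y
  proof -
    define h where "h = (\<lambda>t. v t - u t)"
    define n where "n = norm_L2 T h"
    define \<delta> where "\<delta> = (\<lambda>t. y t - x t)"
    have "n \<ge> 0" by (simp add: n_def norm_L2_nonneg)
    have yac: "abs_continuous_on_interval 0 T y"
      and yder: "AE t in lebesgue_on {0..T}. (y has_vector_derivative G (y t, v t)) (at t)"
      using y unfolding solves_ode_def by auto
    have \<delta>ac: "abs_continuous_on_interval 0 T \<delta>" unfolding \<delta>_def by (rule ac_diff[OF yac xac])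
    have hm: "h \<in> borel_measurable (lebesgue_on {0..T})" using u v by (simp add: h_def)
    have hB: "AE t in lebesgue_on {0..T}. norm (h t) \<le> 2 * B"
      using u(2) v(2)
    proof eventually_elim
      case (elim t)
      then show ?case using norm_triangle_ineq4[of "v t" "u t"] by (simp add: h_def)
    qed
    have hL2: "h \<in> L2 T" by (rule L2_bounded[OF hm hB])
    define I where "I = (LINT t|lebesgue_on {0..T}. norm (h t))"
    have I: "I \<ge> 0" "I \<le> (1 + T) * n"
      using integral_norm_le_norm_L2[OF hL2 \<open>T > 0\<close>] by (simp_all add: I_def n_def integral_nonneg_AE)
    have "D * I \<le> D1 * n"
      using mult_left_mono[OF I(2) D(1)] by (simp add: D1_def mult_ac)
    moreover have "D1 * n < 1"
    proof -
      have "D1 * n \<le> D1 * (1 / (D1 + 1))"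
        using small \<open>D1 \<ge> 0\<close> by (intro mult_left_mono) (auto simp: d_def n_def h_def)
      also have "\<dots> < 1" using \<open>D1 \<ge> 0\<close> by simp
      finally show ?thesis .
    qed
    ultimately have \<delta>le: "norm (\<delta> t) \<le> D1 * n" if "t \<in> {0..T}" for t
      using D(2)[OF y y0 v _ that] by (simp add: \<delta>_def I_def h_def)
    \<comment> \<open>\<open>g\<close> is the first order term, \<open>R\<close> the remainder, and \<open>k\<close> bounds the remainder.\<close>
    define k where "k = (\<lambda>t. P * (e1 * (D1 * n + norm (h t)) + 2 * C * ((D1 * n)\<^sup>2 + (norm (h t))\<^sup>2)))"
    define g where "g = (\<lambda>t. p t \<bullet> G' (x t, u t) (0, h t))"
    have "AE t in lebesgue_on {0..T}. (\<exists>q. (p has_vector_derivative q) (at t) \<and>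
        (\<forall>w. q \<bullet> w = - (p t \<bullet> G' (x t, u t) (w, 0)))) \<and>
        (\<delta> has_vector_derivative G (y t, v t) - G (x t, u t)) (at t) \<and> norm (u t) \<le> B \<and> norm (v t) \<le> B"
      using pder xder yder u(2) v(2)
      by eventually_elim (auto simp: \<delta>_def intro: has_vector_derivative_diff)
    then obtain N where N: "negligible N" and Nder: "\<And>t. \<lbrakk>t \<in> {0..T}; t \<notin> N\<rbrakk> \<Longrightarrow>
        (\<exists>q. (p has_vector_derivative q) (at t) \<and> (\<forall>w. q \<bullet> w = - (p t \<bullet> G' (x t, u t) (w, 0)))) \<and>
        (\<delta> has_vector_derivative G (y t, v t) - G (x t, u t)) (at t) \<and> norm (u t) \<le> B \<and> norm (v t) \<le> B"
      by (rule AE_lebesgue_on_IccE) blast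
    define R where "R = (\<lambda>t. p t \<bullet> (G (y t, v t) - G (x t, u t) - G' (x t, u t) (\<delta> t, h t)))"
    have inK: "(x t, u t) \<in> K" "(y t, v t) \<in> K" if t: "t \<in> {0..T}" "t \<notin> N" for t
    proof -
      have "norm (y t) \<le> norm (x t) + norm (\<delta> t)"
        using norm_triangle_ineq[of "x t" "\<delta> t"] by (simp add: \<delta>_def)
      then show "(x t, u t) \<in> K" "(y t, v t) \<in> K"
        using Bx[OF t(1)] \<delta>le[OF t(1)] \<open>D1 * n < 1\<close> Nder[OF t] by (auto simp: K_def)
    qed
    have "((\<lambda>t. g t + R t) has_integral (p T \<bullet> \<delta> T - p 0 \<bullet> \<delta> 0)) {0..T}"
    proof (rule ac_fundamental_theorem[OF _ ac_inner[OF pac \<delta>ac] N])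
      fix t assume t: "t \<in> {0..T}" "t \<notin> N"
      then obtain q where q: "(p has_vector_derivative q) (at t)"
        "\<And>w. q \<bullet> w = - (p t \<bullet> G' (x t, u t) (w, 0))" using Nder by blast
      have "((\<lambda>t. p t \<bullet> \<delta> t) has_vector_derivative
          p t \<bullet> (G (y t, v t) - G (x t, u t)) + q \<bullet> \<delta> t) (at t)"
        using Nder[OF t] by (intro bounded_bilinear.has_vector_derivative[OF bounded_bilinear_inner] q) auto
      moreover have "p t \<bullet> (G (y t, v t) - G (x t, u t)) + q \<bullet> \<delta> t = g t + R t"
      proof -
        have "G' (x t, u t) (\<delta> t, h t) = G' (x t, u t) (\<delta> t, 0) + G' (x t, u t) (0, h t)"
          by (simp add: blinfun.add_right[symmetric])
        then show ?thesis by (simp add: q(2) g_def R_def inner_diff_right inner_add_right)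
      qed
      ultimately show "((\<lambda>t. p t \<bullet> \<delta> t) has_vector_derivative g t + R t) (at t within {0..T})"
        using has_vector_derivative_at_within by metis
    qed (use \<open>T > 0\<close> in auto)
    then have gR: "((\<lambda>t. g t + R t) has_integral p T \<bullet> \<delta> T) {0..T}"
      using y0 by (simp add: \<delta>_def)
    have "AE t in lebesgue_on {0..T}. norm (g t) \<le> P * (L * (2 * B))"
    proof -
      have "AE t in lebesgue_on {0..T}. norm (h t) \<le> 2 * B \<and> (x t, u t) \<in> K \<and> norm (p t) \<le> P"
        using hB AE_lebesgue_on_IccI[OF N, of 0 T "\<lambda>t. (x t, u t) \<in> K \<and> norm (p t) \<le> P"] inK P(2)
        by auto
      then show ?thesis
      proof eventually_elim
        case (elim t)
        have "norm (g t) \<le> norm (p t) * norm (G' (x t, u t) (0, h t))"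
          unfolding g_def real_norm_def by (rule Cauchy_Schwarz_ineq2)
        also have "\<dots> \<le> P * (L * norm (0::'x, h t))"
          using elim L P(1) by (intro mult_mono order_trans[OF norm_blinfun mult_right_mono]) auto
        also have "\<dots> \<le> P * (L * (2 * B))"
          using elim L(1) P(1) by (intro mult_left_mono) (auto simp: norm_Pair)
        finally show ?case .
      qed
    qed
    moreover have "g \<in> borel_measurable (lebesgue_on {0..T})"
      unfolding g_def by (intro measurable_derivative_along[OF cont] ac_measurable xac pac u hm)
    ultimately have "integrable (lebesgue_on {0..T}) g"
      by (intro integrable_lebesgue_on_Icc_bounded)
    then have gI: "(g has_integral (LINT t|lebesgue_on {0..T}. g t)) {0..T}"
      by (intro has_integral_integral_lebesgue_on) auto
    have RI: "(R has_integral (p T \<bullet> \<delta> T - (LINT t|lebesgue_on {0..T}. g t))) {0..T}"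
      using has_integral_diff[OF gR gI] by simp
    have kint: "integrable (lebesgue_on {0..T}) k"
      using integrable_norm[OF integrable_L2[OF hL2]] hL2 by (auto simp: k_def L2_def)
    have kI: "(k has_integral (LINT t|lebesgue_on {0..T}. k t)) {0..T}"
      using kint by (intro has_integral_integral_lebesgue_on) auto
    have Rk: "norm (R t) \<le> k t" if t: "t \<in> {0..T}" "t \<notin> N" for t
    proof -
      define w where "w = norm (\<delta> t, h t)"
      have w: "(y t, v t) - (x t, u t) = (\<delta> t, h t)" by (simp add: \<delta>_def h_def)
      have w1: "w \<le> D1 * n + norm (h t)"
        unfolding w_def using norm_Pair_le[of "\<delta> t" "h t"] \<delta>le[OF t(1)] by linarith
      have w2: "w\<^sup>2 \<le> 2 * ((D1 * n)\<^sup>2 + (norm (h t))\<^sup>2)"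
      proof -
        have "w\<^sup>2 \<le> (D1 * n + norm (h t))\<^sup>2" using w1 by (intro power_mono) (auto simp: w_def)
        moreover have "0 \<le> (D1 * n - norm (h t))\<^sup>2" by simp
        ultimately show ?thesis by (simp add: power2_sum power2_diff)
      qed
      have "norm (R t) \<le> norm (p t) * norm (G (y t, v t) - G (x t, u t) - G' (x t, u t) (\<delta> t, h t))"
        unfolding R_def real_norm_def by (rule Cauchy_Schwarz_ineq2)
      also have "\<dots> \<le> P * (e1 * w + C * w\<^sup>2)"
        using C(2)[OF inK[OF t], unfolded w, folded w_def] P t(1) by (intro mult_mono) auto
      also have "\<dots> \<le> P * (e1 * (D1 * n + norm (h t)) + C * (2 * ((D1 * n)\<^sup>2 + (norm (h t))\<^sup>2)))"
        using w1 w2 C(1) \<open>e1 > 0\<close> P(1) by (intro mult_left_mono add_mono) simp_all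
      finally show ?thesis by (simp add: k_def mult_ac)
    qed
    have "norm (integral {0..T} (\<lambda>t. if t \<in> N then 0 else R t)) \<le> integral {0..T} (\<lambda>t. if t \<in> N then 0 else k t)"
      using Rk by (intro Henstock_Kurzweil_Integration.integral_norm_bound_integral
          has_integral_integrable[OF has_integral_spike[OF N _ RI]]
          has_integral_integrable[OF has_integral_spike[OF N _ kI]]) auto
    moreover have "integral {0..T} (\<lambda>t. if t \<in> N then 0 else R t) =
        p T \<bullet> \<delta> T - (LINT t|lebesgue_on {0..T}. g t)"
      by (intro integral_unique has_integral_spike[OF N _ RI]) auto
    moreover have "integral {0..T} (\<lambda>t. if t \<in> N then 0 else k t) = (LINT t|lebesgue_on {0..T}. k t)"
      by (intro integral_unique has_integral_spike[OF N _ kI]) auto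
    ultimately have "\<bar>p T \<bullet> \<delta> T - (LINT t|lebesgue_on {0..T}. g t)\<bar> \<le> (LINT t|lebesgue_on {0..T}. k t)"
      by simp
    also have "\<dots> = P * (e1 * (D1 * n * T + I) + 2 * C * ((D1 * n)\<^sup>2 * T + n\<^sup>2))"
    proof -
      have i1: "integrable (lebesgue_on {0..T}) (\<lambda>t. norm (h t))"
        by (rule integrable_norm[OF integrable_L2[OF hL2]])
      have i2: "integrable (lebesgue_on {0..T}) (\<lambda>t. (norm (h t))\<^sup>2)"
        using hL2 by (simp add: L2_def)
      have c: "measure (lebesgue_on {0..T}) {0..T} = T"
        using \<open>T > 0\<close> by (simp add: measure_restrict_space)
      show ?thesis
        using i1 i2 unfolding k_def
        by (simp add: c I_def n_def norm_L2_power2 mult.commute)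
    qed
    also have "\<dots> \<le> P * (e1 * (D1 * n * T + (1 + T) * n) + 2 * C * ((D1 * n)\<^sup>2 * T + n\<^sup>2))"
      using I(2) P(1) C(1) \<open>D1 \<ge> 0\<close> \<open>n \<ge> 0\<close> \<open>e1 > 0\<close> by (intro mult_left_mono add_mono) auto
    also have "\<dots> = (e1 * a) * n + (b * n) * n"
      by (simp add: a_def b_def algebra_simps power2_eq_square)
    also have "\<dots> \<le> (e / 2) * n + (e / 2) * n"
    proof (intro add_mono mult_right_mono e1 \<open>n \<ge> 0\<close>)
      have "b * n \<le> b * (e / (2 * (b + 1)))"
        using small \<open>b \<ge> 0\<close> by (intro mult_left_mono) (auto simp: d_def n_def h_def)
      also have "\<dots> \<le> e / 2" using \<open>b \<ge> 0\<close> \<open>e > 0\<close> by (simp add: field_simps)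
      finally show "b * n \<le> e / 2" .
    qed
    finally show ?thesis
      by (simp add: g_def h_def n_def \<delta>_def inner_diff_right)
  qed
  ultimately show ?thesis by (rule that)
qed


section \<open>Calculus of gradients\<close>

lemma L2_add:
  assumes "f \<in> L2 T" "g \<in> L2 T"
  shows "(\<lambda>t. f t + g t) \<in> L2 T"
proof -
  have [measurable]: "f \<in> borel_measurable (lebesgue_on {0..T})" "g \<in> borel_measurable (lebesgue_on {0..T})"
    using assms by (auto simp: L2_def)
  have "integrable (lebesgue_on {0..T}) (\<lambda>t. (norm (f t + g t))\<^sup>2)"
  proof (rule Bochner_Integration.integrable_bound)
    show "integrable (lebesgue_on {0..T}) (\<lambda>t. 2 * ((norm (f t))\<^sup>2 + (norm (g t))\<^sup>2))"
      using assms by (auto simp: L2_def)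
    show "AE t in lebesgue_on {0..T}. norm ((norm (f t + g t))\<^sup>2) \<le> norm (2 * ((norm (f t))\<^sup>2 + (norm (g t))\<^sup>2))"
    proof (rule AE_I2)
      fix t
      have "(norm (f t + g t))\<^sup>2 \<le> (norm (f t) + norm (g t))\<^sup>2"
        by (intro power_mono norm_triangle_ineq) auto
      moreover have "0 \<le> (norm (f t) - norm (g t))\<^sup>2" by simp
      ultimately show "norm ((norm (f t + g t))\<^sup>2) \<le> norm (2 * ((norm (f t))\<^sup>2 + (norm (g t))\<^sup>2))"
        by (simp add: power2_sum power2_diff)
    qed
  qed measurable
  then show ?thesis by (simp add: L2_def)
qed

lemma L2_scaleR:
  assumes "f \<in> L2 T"
  shows "(\<lambda>t. c *\<^sub>R f t) \<in> L2 T"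
  using assms by (auto simp: L2_def power_mult_distrib)

lemma L2_diff:
  assumes "f \<in> L2 T" "g \<in> L2 T"
  shows "(\<lambda>t. f t - g t) \<in> L2 T"
  using L2_add[OF assms(1) L2_scaleR[OF assms(2), of "-1"]] by simp

lemma L2_zero: "(\<lambda>t. 0) \<in> L2 T"
  by (simp add: L2_def)

lemma integrable_inner_L2:
  assumes "f \<in> L2 T" "g \<in> L2 T"
  shows "integrable (lebesgue_on {0..T}) (\<lambda>t. f t \<bullet> g t)"
proof (rule Bochner_Integration.integrable_bound)
  show "integrable (lebesgue_on {0..T}) (\<lambda>t. (norm (f t))\<^sup>2 + (norm (g t))\<^sup>2)"
    using assms by (auto simp: L2_def)
  have "f \<in> borel_measurable (lebesgue_on {0..T})" "g \<in> borel_measurable (lebesgue_on {0..T})"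
    using assms by (auto simp: L2_def)
  then show "(\<lambda>t. f t \<bullet> g t) \<in> borel_measurable (lebesgue_on {0..T})" by measurable
  show "AE t in lebesgue_on {0..T}. norm (f t \<bullet> g t) \<le> norm ((norm (f t))\<^sup>2 + (norm (g t))\<^sup>2)"
  proof (rule AE_I2)
    fix t
    have "\<bar>f t \<bullet> g t\<bar> \<le> norm (f t) * norm (g t)" by (rule Cauchy_Schwarz_ineq2)
    moreover have "0 \<le> (norm (f t) - norm (g t))\<^sup>2" "0 \<le> norm (f t) * norm (g t)" by simp_all
    ultimately show "norm (f t \<bullet> g t) \<le> norm ((norm (f t))\<^sup>2 + (norm (g t))\<^sup>2)"
      by (simp add: power2_diff)
  qed
qed

lemma norm_L2_scaleR: "norm_L2 T (\<lambda>t. c *\<^sub>R f t) = \<bar>c\<bar> * norm_L2 T f"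
  by (simp add: norm_L2_def power_mult_distrib real_sqrt_mult)

lemma has_L2_gradient_mono:
  assumes "has_L2_gradient T U \<Phi> u g" "V \<subseteq> U"
  shows "has_L2_gradient T V \<Phi> u g"
  unfolding has_L2_gradient_def
proof (intro conjI allI impI)
  show "g \<in> L2 T" using assms(1) by (simp add: has_L2_gradient_def)
  fix e :: real assume "e > 0"
  then obtain d where "d > 0" "\<forall>v\<in>U. norm_L2 T (\<lambda>t. v t - u t) < d \<longrightarrow>
        \<bar>\<Phi> v - \<Phi> u - inner_L2 T g (\<lambda>t. v t - u t)\<bar> \<le> e * norm_L2 T (\<lambda>t. v t - u t)"
    using assms(1) unfolding has_L2_gradient_def by blast
  then show "\<exists>d>0. \<forall>v\<in>V. norm_L2 T (\<lambda>t. v t - u t) < d \<longrightarrow>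
        \<bar>\<Phi> v - \<Phi> u - inner_L2 T g (\<lambda>t. v t - u t)\<bar> \<le> e * norm_L2 T (\<lambda>t. v t - u t)"
    using assms(2) by blast
qed

lemma has_L2_gradient_add:
  assumes \<Phi>: "has_L2_gradient T U \<Phi> u g" and \<Psi>: "has_L2_gradient T U \<Psi> u k"
    and U: "U \<subseteq> L2 T" "u \<in> L2 T"
  shows "has_L2_gradient T U (\<lambda>v. \<Phi> v + \<Psi> v) u (\<lambda>t. g t + k t)"
  unfolding has_L2_gradient_def
proof (intro conjI allI impI)
  have gk: "g \<in> L2 T" "k \<in> L2 T" using \<Phi> \<Psi> by (simp_all add: has_L2_gradient_def)
  show "(\<lambda>t. g t + k t) \<in> L2 T" by (rule L2_add[OF gk])
  fix e :: real assume "e > 0"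
  then have e2: "e / 2 > 0" by simp
  obtain d1 where "d1 > 0" and d1: "\<And>v. v \<in> U \<Longrightarrow> norm_L2 T (\<lambda>t. v t - u t) < d1 \<Longrightarrow>
        \<bar>\<Phi> v - \<Phi> u - inner_L2 T g (\<lambda>t. v t - u t)\<bar> \<le> e / 2 * norm_L2 T (\<lambda>t. v t - u t)"
    using \<Phi> e2 unfolding has_L2_gradient_def by blast
  obtain d2 where "d2 > 0" and d2: "\<And>v. v \<in> U \<Longrightarrow> norm_L2 T (\<lambda>t. v t - u t) < d2 \<Longrightarrow>
        \<bar>\<Psi> v - \<Psi> u - inner_L2 T k (\<lambda>t. v t - u t)\<bar> \<le> e / 2 * norm_L2 T (\<lambda>t. v t - u t)"
    using \<Psi> e2 unfolding has_L2_gradient_def by blast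
  show "\<exists>d>0. \<forall>v\<in>U. norm_L2 T (\<lambda>t. v t - u t) < d \<longrightarrow>
        \<bar>\<Phi> v + \<Psi> v - (\<Phi> u + \<Psi> u) - inner_L2 T (\<lambda>t. g t + k t) (\<lambda>t. v t - u t)\<bar>
          \<le> e * norm_L2 T (\<lambda>t. v t - u t)"
  proof (intro exI[of _ "min d1 d2"] conjI ballI impI)
    fix v assume v: "v \<in> U" "norm_L2 T (\<lambda>t. v t - u t) < min d1 d2"
    have h: "(\<lambda>t. v t - u t) \<in> L2 T" using U v(1) by (intro L2_diff) auto
    have "inner_L2 T (\<lambda>t. g t + k t) (\<lambda>t. v t - u t) =
        inner_L2 T g (\<lambda>t. v t - u t) + inner_L2 T k (\<lambda>t. v t - u t)"
      unfolding inner_L2_def inner_add_left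
      by (intro Bochner_Integration.integral_add integrable_inner_L2 gk h)
    then show "\<bar>\<Phi> v + \<Psi> v - (\<Phi> u + \<Psi> u) - inner_L2 T (\<lambda>t. g t + k t) (\<lambda>t. v t - u t)\<bar>
          \<le> e * norm_L2 T (\<lambda>t. v t - u t)"
      using d1[OF v(1)] d2[OF v(1)] v(2) by linarith
  qed (use \<open>d1 > 0\<close> \<open>d2 > 0\<close> in auto)
qed

lemma has_L2_gradient_cmult:
  assumes \<Phi>: "has_L2_gradient T U \<Phi> u g"
  shows "has_L2_gradient T U (\<lambda>v. c * \<Phi> v) u (\<lambda>t. c *\<^sub>R g t)"
  unfolding has_L2_gradient_def
proof (intro conjI allI impI)
  show "(\<lambda>t. c *\<^sub>R g t) \<in> L2 T" using \<Phi> by (intro L2_scaleR) (simp add: has_L2_gradient_def)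
  fix e :: real assume "e > 0"
  then have "e / (\<bar>c\<bar> + 1) > 0" by simp
  then obtain d where "d > 0" and d: "\<And>v. v \<in> U \<Longrightarrow> norm_L2 T (\<lambda>t. v t - u t) < d \<Longrightarrow>
        \<bar>\<Phi> v - \<Phi> u - inner_L2 T g (\<lambda>t. v t - u t)\<bar> \<le> e / (\<bar>c\<bar> + 1) * norm_L2 T (\<lambda>t. v t - u t)"
    using \<Phi> unfolding has_L2_gradient_def by blast
  show "\<exists>d>0. \<forall>v\<in>U. norm_L2 T (\<lambda>t. v t - u t) < d \<longrightarrow>
        \<bar>c * \<Phi> v - c * \<Phi> u - inner_L2 T (\<lambda>t. c *\<^sub>R g t) (\<lambda>t. v t - u t)\<bar>
          \<le> e * norm_L2 T (\<lambda>t. v t - u t)"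
  proof (intro exI[of _ d] conjI ballI impI)
    fix v assume v: "v \<in> U" "norm_L2 T (\<lambda>t. v t - u t) < d"
    have "\<bar>c * \<Phi> v - c * \<Phi> u - inner_L2 T (\<lambda>t. c *\<^sub>R g t) (\<lambda>t. v t - u t)\<bar> =
        \<bar>c * (\<Phi> v - \<Phi> u - inner_L2 T g (\<lambda>t. v t - u t))\<bar>"
      by (simp add: inner_L2_def right_diff_distrib)
    also have "\<dots> = \<bar>c\<bar> * \<bar>\<Phi> v - \<Phi> u - inner_L2 T g (\<lambda>t. v t - u t)\<bar>" by (rule abs_mult)
    also have "\<dots> \<le> (\<bar>c\<bar> + 1) * (e / (\<bar>c\<bar> + 1) * norm_L2 T (\<lambda>t. v t - u t))"
      by (intro mult_mono d v) auto
    also have "\<dots> = e * norm_L2 T (\<lambda>t. v t - u t)" by simp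
    finally show "\<bar>c * \<Phi> v - c * \<Phi> u - inner_L2 T (\<lambda>t. c *\<^sub>R g t) (\<lambda>t. v t - u t)\<bar>
          \<le> e * norm_L2 T (\<lambda>t. v t - u t)" .
  qed (rule \<open>d > 0\<close>)
qed

lemma has_L2_gradient_sum:
  assumes "finite A" and \<Phi>: "\<And>i. i \<in> A \<Longrightarrow> has_L2_gradient T U (\<Phi> i) u (g i)"
    and U: "U \<subseteq> L2 T" "u \<in> L2 T"
  shows "has_L2_gradient T U (\<lambda>v. \<Sum>i\<in>A. \<Phi> i v) u (\<lambda>t. \<Sum>i\<in>A. g i t)"
  using assms(1) \<Phi>
proof (induction A)
  case empty
  show ?case
    unfolding has_L2_gradient_def
    by (intro conjI allI impI exI[of _ 1]) (auto simp: inner_L2_def L2_zero norm_L2_nonneg)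
next
  case (insert i A)
  then show ?case using has_L2_gradient_add[OF _ _ U] by simp
qed


section \<open>Gradient of the terminal value\<close>

text \<open>The terminal value as a functional of the input; \<open>a\<close> is \<open>\<partial>\<^sub>uG(x,u)\<^sup>T p\<close>.\<close>

lemma terminal_value_has_L2_gradient:
  fixes G :: "'x::euclidean_space \<times> 'u::euclidean_space \<Rightarrow> 'x"
  assumes der: "\<And>z. (G has_derivative blinfun_apply (G' z)) (at z)"
    and cont: "continuous_on UNIV G'" and "T > 0"
    and x: "solves_ode G T u x"
    and u: "u \<in> borel_measurable (lebesgue_on {0..T})" "AE t in lebesgue_on {0..T}. norm (u t) \<le> B"
    and pac: "abs_continuous_on_interval 0 T p"
    and pder: "AE t in lebesgue_on {0..T}. \<exists>q. (p has_vector_derivative q) (at t) \<and>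
        (\<forall>w. q \<bullet> w = - (p t \<bullet> G' (x t, u t) (w, 0)))"
    and a: "AE t in lebesgue_on {0..T}. \<forall>h. a t \<bullet> h = p t \<bullet> G' (x t, u t) (0, h)"
    and U: "\<And>v. v \<in> U \<Longrightarrow> v \<in> borel_measurable (lebesgue_on {0..T})"
      "\<And>v. v \<in> U \<Longrightarrow> AE t in lebesgue_on {0..T}. norm (v t) \<le> B"
    and \<Phi>: "\<And>v. v \<in> U \<Longrightarrow> \<exists>y. solves_ode G T v y \<and> y 0 = x 0 \<and> \<Phi> v = p T \<bullet> y T"
      "\<Phi> u = p T \<bullet> x T"
  shows "has_L2_gradient T U \<Phi> u a"
  unfolding has_L2_gradient_def
proof (intro conjI allI impI)
  have xac: "abs_continuous_on_interval 0 T x" using x by (simp add: solves_ode_def)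
  obtain Bx where Bx: "\<And>t. t \<in> {0..T} \<Longrightarrow> norm (x t) \<le> Bx" using ac_bounded[OF xac] by blast
  obtain P where P: "P \<ge> 0" "\<And>t. t \<in> {0..T} \<Longrightarrow> norm (p t) \<le> P" using ac_bounded[OF pac] by blast
  define K where "K = cball (0::'x) Bx \<times> cball (0::'u) B"
  have K: "compact K" "convex K" by (auto simp: K_def compact_Times convex_Times)
  obtain L where L: "L \<ge> 0" "\<And>z. z \<in> K \<Longrightarrow> norm (G' z) \<le> L"
    using derivative_bound_on_compact[OF der cont K] by metis
  show "a \<in> L2 T"
  proof (rule L2_bounded)
    have "(\<lambda>t. \<Sum>b\<in>Basis. (p t \<bullet> G' (x t, u t) (0, b)) *\<^sub>R b) \<in> borel_measurable (lebesgue_on {0..T})"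
      by (intro borel_measurable_sum borel_measurable_scaleR measurable_derivative_along[OF cont]
          ac_measurable xac pac u borel_measurable_const)
    moreover have "AE t in lebesgue_on {0..T}. (\<Sum>b\<in>Basis. (p t \<bullet> G' (x t, u t) (0, b)) *\<^sub>R b) = a t"
      using a
    proof eventually_elim
      case (elim t)
      then have "(\<Sum>b\<in>Basis. (p t \<bullet> G' (x t, u t) (0, b)) *\<^sub>R b) = (\<Sum>b\<in>Basis. (a t \<bullet> b) *\<^sub>R b)" by simp
      then show ?case by (simp add: euclidean_representation)
    qed
    ultimately show "a \<in> borel_measurable (lebesgue_on {0..T})" by (rule measurable_lebesgue_on_AE)
    have "AE t in lebesgue_on {0..T}. norm (x t) \<le> Bx \<and> norm (p t) \<le> P"
      using Bx P(2) by (intro AE_I2) auto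
    then show "AE t in lebesgue_on {0..T}. norm (a t) \<le> P * L"
      using a u(2)
    proof eventually_elim
      case (elim t)
      then have "(x t, u t) \<in> K" by (auto simp: K_def)
      \<comment> \<open>Testing the defining identity of \<open>a t\<close> with \<open>a t\<close> itself bounds its norm.\<close>
      have "(norm (a t))\<^sup>2 = p t \<bullet> G' (x t, u t) (0, a t)"
        using elim by (simp add: power2_norm_eq_inner)
      also have "\<dots> \<le> norm (p t) * norm (G' (x t, u t) (0, a t))" by (rule norm_cauchy_schwarz)
      also have "\<dots> \<le> P * (L * norm (0::'x, a t))"
        using elim L(2)[OF \<open>_ \<in> K\<close>] P(1) by (intro mult_mono order_trans[OF norm_blinfun mult_right_mono]) auto
      finally have "norm (a t) * norm (a t) \<le> (P * L) * norm (a t)"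
        by (simp add: norm_Pair power2_eq_square)
      then show ?case using P(1) L(1) by (cases "norm (a t) = 0") auto
    qed
  qed
  fix e :: real assume "e > 0"
  obtain d where "d > 0" and d:
    "\<And>v y. \<lbrakk>solves_ode G T v y; y 0 = x 0; v \<in> borel_measurable (lebesgue_on {0..T});
        AE t in lebesgue_on {0..T}. norm (v t) \<le> B; norm_L2 T (\<lambda>t. v t - u t) < d\<rbrakk> \<Longrightarrow>
      \<bar>p T \<bullet> y T - p T \<bullet> x T
        - (LINT t|lebesgue_on {0..T}. p t \<bullet> G' (x t, u t) (0, v t - u t))\<bar>
      \<le> e * norm_L2 T (\<lambda>t. v t - u t)"
    using terminal_value_expansion[OF der cont \<open>T > 0\<close> x u pac pder \<open>e > 0\<close>] by blast
  show "\<exists>d>0. \<forall>v\<in>U. norm_L2 T (\<lambda>t. v t - u t) < d \<longrightarrow>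
        \<bar>\<Phi> v - \<Phi> u - inner_L2 T a (\<lambda>t. v t - u t)\<bar> \<le> e * norm_L2 T (\<lambda>t. v t - u t)"
  proof (intro exI[of _ d] conjI ballI impI)
    fix v assume v: "v \<in> U" "norm_L2 T (\<lambda>t. v t - u t) < d"
    obtain y where y: "solves_ode G T v y" "y 0 = x 0" "\<Phi> v = p T \<bullet> y T" using \<Phi>(1)[OF v(1)] by blast
    have "(\<lambda>t. p t \<bullet> G' (x t, u t) (0, v t - u t)) \<in> borel_measurable (lebesgue_on {0..T})"
      by (intro measurable_derivative_along[OF cont] ac_measurable xac pac u borel_measurable_diff U v)
    moreover have "AE t in lebesgue_on {0..T}. p t \<bullet> G' (x t, u t) (0, v t - u t) = a t \<bullet> (v t - u t)"
      using a by eventually_elim simp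
    moreover from this have "(\<lambda>t. a t \<bullet> (v t - u t)) \<in> borel_measurable (lebesgue_on {0..T})"
      using calculation(1) by (rule measurable_lebesgue_on_AE[rotated])
    ultimately have "inner_L2 T a (\<lambda>t. v t - u t) =
        (LINT t|lebesgue_on {0..T}. p t \<bullet> G' (x t, u t) (0, v t - u t))"
      unfolding inner_L2_def by (intro integral_cong_AE) (auto elim: eventually_mono)
    then show "\<bar>\<Phi> v - \<Phi> u - inner_L2 T a (\<lambda>t. v t - u t)\<bar> \<le> e * norm_L2 T (\<lambda>t. v t - u t)"
      using d[OF y(1,2) U(1)[OF v(1)] U(2)[OF v(1)] v(2)] by (simp add: y(3) \<Phi>(2))
  qed (rule \<open>d > 0\<close>)
qed


section \<open>Admissible controls and the quadratic penalty\<close>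

lemma U_ad_measurable: "v \<in> U_ad T \<Longrightarrow> v \<in> borel_measurable (lebesgue_on {0..T})"
  by (simp add: U_ad_def)

lemma U_ad_norm_le:
  fixes v :: "('r::finite) control"
  assumes "v \<in> U_ad T"
  shows "AE t in lebesgue_on {0..T}. norm (v t) \<le> real CARD('r)"
proof -
  have "AE t in lebesgue_on {0..T}. \<forall>i. 0 \<le> v t $ i \<and> v t $ i \<le> 1"
    using assms by (simp add: U_ad_def)
  then show ?thesis
  proof eventually_elim
    case (elim t)
    have "norm (v t) \<le> (\<Sum>i\<in>UNIV. \<bar>v t $ i\<bar>)" by (rule norm_le_l1_cart)
    also have "\<dots> \<le> (\<Sum>i\<in>(UNIV::'r set). 1)" using elim by (intro sum_mono) auto
    finally show ?case by simp
  qed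
qed

lemma U_ad_subset_L2: "U_ad T \<subseteq> (L2 T :: ('r::finite) control set)"
proof
  fix v :: "'r control" assume "v \<in> U_ad T"
  then show "v \<in> L2 T"
    using L2_bounded[of v T "real CARD('r)"] U_ad_measurable[of v T] U_ad_norm_le[of v T] by simp
qed

lemma measurable_vec_nth:
  fixes f :: "'a \<Rightarrow> real ^ 'n"
  assumes "f \<in> borel_measurable M"
  shows "(\<lambda>t. f t $ i) \<in> borel_measurable M"
  unfolding cart_eq_inner_axis by (intro borel_measurable_inner assms borel_measurable_const)

lemma measurable_vec_lambda:
  fixes f :: "'n::finite \<Rightarrow> 'a \<Rightarrow> real"
  assumes "\<And>i. f i \<in> borel_measurable M"
  shows "(\<lambda>t. \<chi> i. f i t) \<in> borel_measurable M"
proof (rule borel_measurable_euclidean_space[THEN iffD2], rule ballI)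
  fix b :: "real ^ 'n" assume "b \<in> Basis"
  then obtain i where "b = axis i 1" by (auto simp: Basis_vec_def)
  then show "(\<lambda>t. (\<chi> i. f i t) \<bullet> b) \<in> borel_measurable M"
    using assms[of i] by (simp add: inner_axis)
qed

lemma pos_part_square_expansion:
  "\<bar>(pos_part (a + b))\<^sup>2 - (pos_part a)\<^sup>2 - 2 * pos_part a * b\<bar> \<le> b\<^sup>2"
proof -
  consider "a \<ge> 0" "a + b \<ge> 0" | "a \<ge> 0" "a + b < 0" | "a < 0" "a + b \<ge> 0" | "a < 0" "a + b < 0"
    by linarith
  then show ?thesis
  proof cases
    case 1
    then show ?thesis by (simp add: pos_part_def power2_eq_square algebra_simps)
  next
    case 2
    then have "0 \<le> (a + b) * (a + b)" "0 \<le> - (a * b)" "0 \<le> a * (- a - b)"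
      by (auto simp: mult_nonneg_nonpos mult_nonneg_nonneg mult_nonpos_nonpos)
    then show ?thesis
      using 2 by (auto simp: pos_part_def power2_eq_square abs_le_iff algebra_simps)
  next
    case 3
    then have "(a + b)\<^sup>2 \<le> b\<^sup>2" by (intro power_mono) auto
    then show ?thesis using 3 by (simp add: pos_part_def)
  next
    case 4
    then show ?thesis by (simp add: pos_part_def)
  qed
qed

lemma S_cost_has_L2_gradient:
  fixes u :: "('r::finite) control"
  assumes u: "u \<in> U_ad T"
  shows "has_L2_gradient T (U_ad T) (S_cost T Nmax) u
    (\<lambda>t. (2 * pos_part ((\<Sum>i\<in>UNIV. u t $ i) - real Nmax)) *\<^sub>R 1)"
proof -
  define m where "m = real CARD('r)"
  have "m > 0" by (simp add: m_def)
  define s where "s = (\<lambda>(v :: 'r control) t. pos_part ((\<Sum>i\<in>UNIV. v t $ i) - real Nmax))"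
  have sm: "s v \<in> borel_measurable (lebesgue_on {0..T})" if "v \<in> U_ad T" for v
    unfolding s_def pos_part_def
    by (intro borel_measurable_max borel_measurable_diff borel_measurable_sum measurable_vec_nth
        U_ad_measurable[OF that] borel_measurable_const)
  have sB: "AE t in lebesgue_on {0..T}. \<bar>s v t\<bar> \<le> m" if "v \<in> U_ad T" for v
  proof -
    have "AE t in lebesgue_on {0..T}. \<forall>i. 0 \<le> v t $ i \<and> v t $ i \<le> 1"
      using that by (simp add: U_ad_def)
    then show ?thesis
    proof eventually_elim
      case (elim t)
      have "(\<Sum>i\<in>UNIV. v t $ i) \<le> (\<Sum>i\<in>(UNIV::'r set). 1)" using elim by (intro sum_mono) auto
      then show ?case by (auto simp: s_def pos_part_def m_def)
    qed
  qed
  have s2: "integrable (lebesgue_on {0..T}) (\<lambda>t. (s v t)\<^sup>2)" if "v \<in> U_ad T" for v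
    using L2_bounded[of "s v" T m] sm[OF that] sB[OF that] by (simp add: L2_def)
  have gL2: "(\<lambda>t. (2 * s u t) *\<^sub>R 1) \<in> (L2 T :: 'r control set)"
  proof (rule L2_bounded)
    show "(\<lambda>t. (2 * s u t) *\<^sub>R (1 :: real ^ 'r)) \<in> borel_measurable (lebesgue_on {0..T})"
      by (intro borel_measurable_scaleR borel_measurable_times sm[OF u] borel_measurable_const)
    show "AE t in lebesgue_on {0..T}. norm ((2 * s u t) *\<^sub>R (1 :: real ^ 'r)) \<le> 2 * m * norm (1 :: real ^ 'r)"
      using sB[OF u] by eventually_elim (auto intro!: mult_right_mono)
  qed
  have main: "\<bar>S_cost T Nmax v - S_cost T Nmax u
      - inner_L2 T (\<lambda>t. (2 * s u t) *\<^sub>R 1) (\<lambda>t. v t - u t)\<bar> \<le> m\<^sup>2 * (norm_L2 T (\<lambda>t. v t - u t))\<^sup>2"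
    if v: "v \<in> U_ad T" for v
  proof -
    define h where "h = (\<lambda>t. v t - u t)"
    have hL2: "h \<in> L2 T" unfolding h_def using U_ad_subset_L2 u v by (intro L2_diff) auto
    have gh: "integrable (lebesgue_on {0..T}) (\<lambda>t. ((2 * s u t) *\<^sub>R 1) \<bullet> h t)"
      by (rule integrable_inner_L2[OF gL2 hL2])
    have pw: "\<bar>(s v t)\<^sup>2 - (s u t)\<^sup>2 - ((2 * s u t) *\<^sub>R 1) \<bullet> h t\<bar> \<le> m\<^sup>2 * (norm (h t))\<^sup>2" for t
    proof -
      define b where "b = (\<Sum>i\<in>UNIV. h t $ i)"
      have b1: "1 \<bullet> h t = b" by (simp add: b_def inner_vec_def)
      have vb: "s v t = pos_part (((\<Sum>i\<in>UNIV. u t $ i) - real Nmax) + b)"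
        by (simp add: s_def b_def h_def sum_subtractf)
      have "\<bar>(s v t)\<^sup>2 - (s u t)\<^sup>2 - ((2 * s u t) *\<^sub>R 1) \<bullet> h t\<bar> \<le> b\<^sup>2"
        using pos_part_square_expansion[of "(\<Sum>i\<in>UNIV. u t $ i) - real Nmax" b]
        unfolding vb inner_scaleR_left b1 by (simp add: s_def)
      also have "\<dots> \<le> (m * norm (h t))\<^sup>2"
      proof -
        have "\<bar>b\<bar> \<le> (\<Sum>i\<in>UNIV. \<bar>h t $ i\<bar>)" unfolding b_def by (rule sum_abs)
        also have "\<dots> \<le> (\<Sum>i\<in>(UNIV::'r set). norm (h t))"
          by (intro sum_mono component_le_norm_cart)
        also have "\<dots> = m * norm (h t)" by (simp add: m_def)
        finally show ?thesis by (rule abs_le_square_iff[THEN iffD1, OF order_trans]) auto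
      qed
      finally show ?thesis by (simp add: power_mult_distrib)
    qed
    have Ss: "S_cost T Nmax v' = (LINT t|lebesgue_on {0..T}. (s v' t)\<^sup>2)" for v'
      by (simp add: S_cost_def s_def)
    have "S_cost T Nmax v - S_cost T Nmax u - inner_L2 T (\<lambda>t. (2 * s u t) *\<^sub>R 1) h =
        (LINT t|lebesgue_on {0..T}. (s v t)\<^sup>2 - (s u t)\<^sup>2 - ((2 * s u t) *\<^sub>R 1) \<bullet> h t)"
      using s2[OF v] s2[OF u] gh
      by (simp add: Ss inner_L2_def)
    also have "\<bar>\<dots>\<bar> \<le> (LINT t|lebesgue_on {0..T}. m\<^sup>2 * (norm (h t))\<^sup>2)"
    proof -
      have "norm (LINT t|lebesgue_on {0..T}. (s v t)\<^sup>2 - (s u t)\<^sup>2 - ((2 * s u t) *\<^sub>R 1) \<bullet> h t) \<le>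
          (LINT t|lebesgue_on {0..T}. m\<^sup>2 * (norm (h t))\<^sup>2)"
        using pw hL2 by (intro Bochner_Integration.integral_norm_bound_integral
            Bochner_Integration.integrable_diff s2 u v gh) (auto simp: L2_def)
      then show ?thesis by simp
    qed
    also have "\<dots> = m\<^sup>2 * (norm_L2 T h)\<^sup>2" by (simp add: norm_L2_power2)
    finally show ?thesis by (simp add: h_def)
  qed
  have "has_L2_gradient T (U_ad T) (S_cost T Nmax) u (\<lambda>t. (2 * s u t) *\<^sub>R 1)"
    unfolding has_L2_gradient_def
  proof (intro conjI allI impI gL2)
    fix e :: real assume "e > 0"
    show "\<exists>d>0. \<forall>v\<in>U_ad T. norm_L2 T (\<lambda>t. v t - u t) < d \<longrightarrow>
        \<bar>S_cost T Nmax v - S_cost T Nmax u - inner_L2 T (\<lambda>t. (2 * s u t) *\<^sub>R 1) (\<lambda>t. v t - u t)\<bar>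
          \<le> e * norm_L2 T (\<lambda>t. v t - u t)"
    proof (intro exI[of _ "e / m\<^sup>2"] conjI ballI impI)
      fix v assume v: "v \<in> U_ad T" "norm_L2 T (\<lambda>t. v t - u t) < e / m\<^sup>2"
      define n where "n = norm_L2 T (\<lambda>t. v t - u t)"
      have "m\<^sup>2 * n\<^sup>2 = (m\<^sup>2 * n) * n" by (simp add: power2_eq_square)
      also have "\<dots> \<le> e * n"
        using v(2) \<open>m > 0\<close> by (intro mult_right_mono) (auto simp: n_def norm_L2_nonneg field_simps)
      finally show "\<bar>S_cost T Nmax v - S_cost T Nmax u - inner_L2 T (\<lambda>t. (2 * s u t) *\<^sub>R 1) (\<lambda>t. v t - u t)\<bar>
          \<le> e * norm_L2 T (\<lambda>t. v t - u t)"
        using main[OF v(1)] by (simp add: n_def)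
    qed (use \<open>e > 0\<close> \<open>m > 0\<close> in simp)
  qed
  then show ?thesis by (simp add: s_def)
qed


section \<open>The controlled system as an ordinary differential equation\<close>

lemma jacobian_mult_vec:
  fixes f :: "real ^ 'm::finite \<Rightarrow> real ^ 'n::finite"
  assumes "(f has_derivative D) (at x)"
  shows "jacobian f (at x) *v h = D h"
proof -
  have "(f has_derivative (\<lambda>h. jacobian f (at x) *v h)) (at x)"
    using assms by (simp add: jacobian_works[symmetric] differentiable_def) blast
  then show ?thesis using has_derivative_unique[OF assms] by metis
qed

text \<open>\<open>M\<close> and \<open>N\<close> are the partial Jacobians of the closed loop field \<open>(\<rho>,v) \<mapsto> f(\<rho>, \<phi>(\<rho>,v))\<close>.\<close>

lemma system_matrices_mult_vec:
  fixes f :: "('r::finite, 'c::finite) density \<times> 'r fluxes \<Rightarrow> ('r, 'c) density"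
    and \<phi> :: "('r, 'c) density \<times> (real ^ 'r) \<Rightarrow> 'r fluxes"
  assumes f: "(f has_derivative f') (at (\<rho>, \<phi> (\<rho>, v)))"
    and \<phi>: "(\<phi> has_derivative \<phi>') (at (\<rho>, v))"
    and G: "((\<lambda>z. f (fst z, \<phi> z)) has_derivative G') (at (\<rho>, v))"
  shows "M_matrix f \<phi> \<rho> (\<phi> (\<rho>, v)) v *v w = G' (w, 0)"
    and "N_matrix f \<phi> \<rho> (\<phi> (\<rho>, v)) v *v h = G' (0, h)"
proof -
  have d1: "((\<lambda>r. f (r, \<phi> (\<rho>, v))) has_derivative (\<lambda>w. f' (w, 0))) (at \<rho>)"
    by (rule has_derivative_compose[OF has_derivative_Pair[OF has_derivative_ident has_derivative_const] f])
  have d2: "((\<lambda>g. f (\<rho>, g)) has_derivative (\<lambda>k. f' (0, k))) (at (\<phi> (\<rho>, v)))"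
    by (rule has_derivative_compose[OF has_derivative_Pair[OF has_derivative_const has_derivative_ident] f])
  have d3: "((\<lambda>r. \<phi> (r, v)) has_derivative (\<lambda>w. \<phi>' (w, 0))) (at \<rho>)"
    by (rule has_derivative_compose[OF has_derivative_Pair[OF has_derivative_ident has_derivative_const] \<phi>])
  have d4: "((\<lambda>v. \<phi> (\<rho>, v)) has_derivative (\<lambda>h. \<phi>' (0, h))) (at v)"
    by (rule has_derivative_compose[OF has_derivative_Pair[OF has_derivative_const has_derivative_ident] \<phi>])
  have "((\<lambda>z. (fst z, \<phi> z)) has_derivative (\<lambda>z. (fst z, \<phi>' z))) (at (\<rho>, v))"
    by (intro has_derivative_Pair has_derivative_fst has_derivative_ident \<phi>)
  then have "((\<lambda>z. f (fst z, \<phi> z)) has_derivative (\<lambda>z. f' (fst z, \<phi>' z))) (at (\<rho>, v))"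
    using has_derivative_compose[of "\<lambda>z. (fst z, \<phi> z)" _ "(\<rho>, v)" UNIV f f'] f by simp
  then have G': "G' z = f' (fst z, \<phi>' z)" for z
    using fun_cong[OF has_derivative_unique[OF G]] by simp
  have add: "f' (w, k) = f' (w, 0) + f' (0, k)" for w k
    using linear_add[OF has_derivative_linear[OF f], of "(w, 0)" "(0, k)"] by simp
  show "M_matrix f \<phi> \<rho> (\<phi> (\<rho>, v)) v *v w = G' (w, 0)"
    unfolding M_matrix_def matrix_vector_mult_add_rdistrib matrix_vector_mul_assoc[symmetric]
      jacobian_mult_vec[OF d1] jacobian_mult_vec[OF d2] jacobian_mult_vec[OF d3]
    by (simp add: G' add[symmetric])
  show "N_matrix f \<phi> \<rho> (\<phi> (\<rho>, v)) v *v h = G' (0, h)"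
    unfolding N_matrix_def matrix_vector_mul_assoc[symmetric]
      jacobian_mult_vec[OF d2] jacobian_mult_vec[OF d4]
    by (simp add: G')
qed

lemma inner_transpose_mult_vec: "(transpose A *v x) \<bullet> y = x \<bullet> (A *v (y :: real ^ 'n))"
  for A :: "real ^ 'n ^ 'm" and x :: "real ^ 'm"
  unfolding transpose_matrix_vector by (rule dot_lmul_matrix)

lemma solves_system_imp_solves_ode:
  assumes "solves_system f \<phi> T \<rho>0 v y g"
  shows "solves_ode (\<lambda>z. f (fst z, \<phi> z)) T v y" "y 0 = \<rho>0"
proof -
  have "AE t in lebesgue_on {0..T}. (y has_vector_derivative f (y t, g t)) (at t)"
    "AE t in lebesgue_on {0..T}. g t = \<phi> (y t, v t)"
    using assms by (auto simp: solves_system_def)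
  then have "AE t in lebesgue_on {0..T}. (y has_vector_derivative f (y t, \<phi> (y t, v t))) (at t)"
    by eventually_elim simp
  then show "solves_ode (\<lambda>z. f (fst z, \<phi> z)) T v y" "y 0 = \<rho>0"
    using assms by (auto simp: solves_ode_def solves_system_def)
qed


section \<open>First order optimality\<close>

text \<open>The gradient is tested against the direction that moves every control component to the bound
  opposite to the sign of its gradient component, and leaves the others unchanged.\<close>

lemma local_minimizer_stationary:
  fixes u :: "('r::finite) control"
  assumes loc: "local_minimizer T J u" and grad: "has_L2_gradient T (U_ad T) J u g"
  shows "AE t in lebesgue_on {0..T}. \<forall>i. min (u t $ i) (max (u t $ i - 1) (g t $ i)) = 0"
proof -
  have u: "u \<in> U_ad T" using loc by (simp add: local_minimizer_def)
  obtain r where "r > 0" and r: "\<And>v. v \<in> U_ad T \<Longrightarrow>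
      (AE t in lebesgue_on {0..T}. norm (v t - u t) \<le> r) \<Longrightarrow> J u \<le> J v"
    using loc unfolding local_minimizer_def by blast
  have gL2: "g \<in> L2 T" using grad by (simp add: has_L2_gradient_def)
  have u01: "AE t in lebesgue_on {0..T}. \<forall>i. 0 \<le> u t $ i \<and> u t $ i \<le> 1"
    using u by (simp add: U_ad_def)
  have um: "u \<in> borel_measurable (lebesgue_on {0..T})" by (rule U_ad_measurable[OF u])
  have gm: "g \<in> borel_measurable (lebesgue_on {0..T})" using gL2 by (simp add: L2_def)
  define w where "w = (\<lambda>t. \<chi> i. if g t $ i > 0 then 0 else if g t $ i < 0 then 1 else u t $ i)"
  have w01: "AE t in lebesgue_on {0..T}. \<forall>i. 0 \<le> w t $ i \<and> w t $ i \<le> 1"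
    using u01 by eventually_elim (simp add: w_def)
  have wm: "w \<in> borel_measurable (lebesgue_on {0..T})"
  proof -
    have [measurable]: "(\<lambda>t. g t $ i) \<in> borel_measurable (lebesgue_on {0..T})"
      "(\<lambda>t. u t $ i) \<in> borel_measurable (lebesgue_on {0..T})" for i
      by (intro measurable_vec_nth gm um)+
    show ?thesis unfolding w_def by (rule measurable_vec_lambda) measurable
  qed
  have w: "w \<in> U_ad T" using w01 wm by (simp add: U_ad_def)
  define h where "h = (\<lambda>t. w t - u t)"
  have hL2: "h \<in> L2 T" unfolding h_def using U_ad_subset_L2 u w by (intro L2_diff) auto
  have sh: "(\<lambda>t. u t + s *\<^sub>R h t) \<in> U_ad T" if "0 \<le> s" "s \<le> 1" for s
  proof -
    have "AE t in lebesgue_on {0..T}. \<forall>i. 0 \<le> (u t + s *\<^sub>R h t) $ i \<and> (u t + s *\<^sub>R h t) $ i \<le> 1"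
      using u01 w01
    proof eventually_elim
      case (elim t)
      show ?case
      proof
        fix i
        have "(u t + s *\<^sub>R h t) $ i = (1 - s) * (u t $ i) + s * (w t $ i)"
          by (simp add: h_def algebra_simps)
        moreover have "0 \<le> (1 - s) * (u t $ i) + s * (w t $ i)" using elim that by simp
        moreover have "(1 - s) * (u t $ i) + s * (w t $ i) \<le> (1 - s) * 1 + s * 1"
          using elim that by (intro add_mono mult_left_mono) auto
        ultimately show "0 \<le> (u t + s *\<^sub>R h t) $ i \<and> (u t + s *\<^sub>R h t) $ i \<le> 1" by simp
      qed
    qed
    moreover have "(\<lambda>t. u t + s *\<^sub>R h t) \<in> borel_measurable (lebesgue_on {0..T})"
      unfolding h_def using um wm by measurable
    ultimately show ?thesis by (simp add: U_ad_def)
  qed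
  have hB: "AE t in lebesgue_on {0..T}. norm (h t) \<le> 2 * real CARD('r)"
    using U_ad_norm_le[OF u] U_ad_norm_le[OF w]
  proof eventually_elim
    case (elim t)
    then show ?case using norm_triangle_ineq4[of "w t" "u t"] by (simp add: h_def)
  qed
  have variational: "inner_L2 T g h \<ge> 0"
  proof -
    define n where "n = norm_L2 T h"
    have "n \<ge> 0" by (simp add: n_def norm_L2_nonneg)
    have "- inner_L2 T g h \<le> 0"
    proof (rule field_le_epsilon)
      fix e' :: real assume "e' > 0"
      define e where "e = e' / (n + 1)"
      have "e > 0" using \<open>e' > 0\<close> \<open>n \<ge> 0\<close> by (simp add: e_def)
      then obtain d where "d > 0" and d: "\<And>v. v \<in> U_ad T \<Longrightarrow> norm_L2 T (\<lambda>t. v t - u t) < d \<Longrightarrow>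
          \<bar>J v - J u - inner_L2 T g (\<lambda>t. v t - u t)\<bar> \<le> e * norm_L2 T (\<lambda>t. v t - u t)"
        using grad unfolding has_L2_gradient_def by blast
      \<comment> \<open>The step is at most \<open>1\<close> for admissibility, small in \<open>L\<^sup>2\<close> for the expansion of \<open>J\<close>, and
        small in \<open>L\<^sup>\<infinity>\<close> for local minimality.\<close>
      define s where "s = min 1 (min (d / (n + 1)) (r / (2 * real CARD('r))))"
      have s: "s > 0" "s \<le> 1" using \<open>d > 0\<close> \<open>n \<ge> 0\<close> \<open>r > 0\<close> by (auto simp: s_def)
      have sU: "(\<lambda>t. u t + s *\<^sub>R h t) \<in> U_ad T" using s by (intro sh) auto
      have "s * n < d"
      proof -
        have "s * n \<le> d / (n + 1) * n" using \<open>n \<ge> 0\<close> by (intro mult_right_mono) (auto simp: s_def)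
        also have "\<dots> < d" using \<open>n \<ge> 0\<close> \<open>d > 0\<close> by (simp add: field_simps)
        finally show ?thesis .
      qed
      then have "\<bar>J (\<lambda>t. u t + s *\<^sub>R h t) - J u - s * inner_L2 T g h\<bar> \<le> e * (s * n)"
        using d[OF sU] s by (simp add: norm_L2_scaleR n_def[symmetric]) (simp add: inner_L2_def)
      moreover have "J u \<le> J (\<lambda>t. u t + s *\<^sub>R h t)"
      proof (rule r[OF sU])
        show "AE t in lebesgue_on {0..T}. norm (u t + s *\<^sub>R h t - u t) \<le> r"
          using hB
        proof eventually_elim
          case (elim t)
          have "s * norm (h t) \<le> r / (2 * real CARD('r)) * (2 * real CARD('r))"
            using elim s \<open>r > 0\<close> by (intro mult_mono) (auto simp: s_def)
          then show ?case using s by simp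
        qed
      qed
      ultimately have "s * (- inner_L2 T g h) \<le> s * (e * n)" by (simp add: mult_ac)
      then have "- inner_L2 T g h \<le> e * n" using s(1) by (rule mult_left_le_imp_le)
      also have "\<dots> \<le> e'"
        using \<open>e' > 0\<close> \<open>n \<ge> 0\<close> by (simp add: e_def field_simps)
      finally show "- inner_L2 T g h \<le> 0 + e'" by simp
    qed
    then show ?thesis by simp
  qed
  have sign: "AE t in lebesgue_on {0..T}. \<forall>i. g t $ i * h t $ i \<le> 0"
    using u01
  proof eventually_elim
    case (elim t)
    then show ?case
      by (auto simp: h_def w_def mult_le_0_iff)
  qed
  have int: "integrable (lebesgue_on {0..T}) (\<lambda>t. - (g t \<bullet> h t))"
    using integrable_inner_L2[OF gL2 hL2] by simp
  have nn: "AE t in lebesgue_on {0..T}. 0 \<le> - (g t \<bullet> h t)"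
    using sign by eventually_elim (simp add: inner_vec_def sum_nonpos)
  have "(LINT t|lebesgue_on {0..T}. - (g t \<bullet> h t)) = 0"
    using integral_nonneg_AE[OF nn] variational by (simp add: inner_L2_def)
  then have "AE t in lebesgue_on {0..T}. - (g t \<bullet> h t) = 0"
    using integral_nonneg_eq_0_iff_AE[OF int nn] by simp
  then show ?thesis
    using sign u01
  proof eventually_elim
    case (elim t)
    have "(\<Sum>i\<in>UNIV. - (g t $ i * h t $ i)) = 0"
      using elim(1) by (simp add: inner_vec_def sum_negf)
    then have zero: "g t $ i * h t $ i = 0" for i
      using elim(2) by (subst (asm) sum_nonneg_eq_0_iff) auto
    show ?case
    proof
      fix i
      show "min (u t $ i) (max (u t $ i - 1) (g t $ i)) = 0"
        using zero[of i] elim(3)[rule_format, of i]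
        by (auto simp: h_def w_def min_def max_def split: if_splits)
    qed
  qed
qed

theorem theorem7:
  fixes \<Delta>x \<rho>0 :: "('r::finite, 'c::{finite,linorder}) density"
    and \<F> :: "'r \<Rightarrow> real \<Rightarrow> real \<times> real \<Rightarrow> real"
    and fFV :: "('r, 'c) density \<times> 'r fluxes \<Rightarrow> ('r, 'c) density"
    and \<phi>LP :: "('r, 'c) density \<times> (real ^ 'r) \<Rightarrow> 'r fluxes"
    and \<epsilon> T \<theta>S \<theta>B \<nu> :: real
    and \<chi>path :: "'r set"
    and Nmax :: nat
    and TV :: "real \<Rightarrow> (real \<Rightarrow> real) \<Rightarrow> real"
    and J :: "'r control \<Rightarrow> real"
    and u :: "'r control"
    and \<rho> p :: "real \<Rightarrow> ('r, 'c) density"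
    and \<gamma> :: "real \<Rightarrow> 'r fluxes"
    and gradTV :: "'r \<Rightarrow> real \<Rightarrow> real ^ 'r"
    and gradJ \<Lambda> :: "real \<Rightarrow> real ^ 'r"
  assumes "CARD('c) \<ge> 2"
    and "\<And>k. \<Delta>x $ k > 0"
    and "\<And>i. C1_regularization (\<F> i) llf_flux" and "\<epsilon> > 0"
    and "fFV = fv_field \<Delta>x (\<lambda>i. \<F> i \<epsilon>)"
    and "C1 fFV" and "C1 \<phi>LP"
    and "T > 0" and "\<And>k. 0 \<le> \<rho>0 $ k \<and> \<rho>0 $ k \<le> 1"
    and "\<And>v. v \<in> U_ad T \<Longrightarrow>
           \<exists>r g. solves_system fFV \<phi>LP T \<rho>0 v r g \<and>
             (\<forall>r' g'. solves_system fFV \<phi>LP T \<rho>0 v r' g' \<longrightarrow> (\<forall>t\<in>{0..T}. r' t = r t))"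
    and "Nmax > 0" and "\<theta>S \<ge> 0" and "\<theta>B \<ge> 0" and "\<nu> > 0"
    and "L2_functional T (TV \<nu>)"
    and "\<And>v. v \<in> L2 T \<Longrightarrow> L2_differentiable_at T (TV \<nu>) v"
    and "J = (\<lambda>v. path_vector \<chi>path \<bullet> density_of fFV \<phi>LP T \<rho>0 v T
                  + \<theta>S / 2 * S_cost T Nmax v + \<theta>B * B_cost (TV \<nu>) v)"
    and "local_minimizer T J u"
    and "solves_system fFV \<phi>LP T \<rho>0 u \<rho> \<gamma>"
    and "adjoint_state fFV \<phi>LP T (path_vector \<chi>path) u \<rho> \<gamma> p"
    and "\<And>i. has_L2_gradient T (L2 T) (\<lambda>v. TV \<nu> (\<lambda>t. v t $ i)) u (gradTV i)"
    and "gradJ = (\<lambda>t. transpose (N_matrix fFV \<phi>LP (\<rho> t) (\<gamma> t) (u t)) *v p t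
                  + (\<theta>S * pos_part ((\<Sum>i\<in>UNIV. u t $ i) - real Nmax)) *\<^sub>R 1
                  + \<theta>B *\<^sub>R (\<Sum>i\<in>UNIV. gradTV i t))"
    and "\<Lambda> = (\<lambda>t. \<chi> i. min (u t $ i) (max (u t $ i - 1) (gradJ t $ i)))"
  shows "has_L2_gradient T (U_ad T) J u gradJ \<and>
         (AE t in lebesgue_on {0..T}. \<Lambda> t = 0)"
proof
  let ?G = "\<lambda>z. fFV (fst z, \<phi>LP z)"
  let ?c = "path_vector \<chi>path :: ('r, 'c) density"
  note unique = assms(10) and loc = assms(18) and sys = assms(19) and adj = assms(20)
  have u: "u \<in> U_ad T" using loc by (simp add: local_minimizer_def)
  obtain f' where f: "\<And>z. (fFV has_derivative blinfun_apply (f' z)) (at z)"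
    using \<open>C1 fFV\<close> unfolding C1_def by blast
  obtain \<phi>' where \<phi>: "\<And>z. (\<phi>LP has_derivative blinfun_apply (\<phi>' z)) (at z)"
    using \<open>C1 \<phi>LP\<close> unfolding C1_def by blast
  obtain G' where G: "\<And>z. (?G has_derivative blinfun_apply (G' z)) (at z)"
    and contG: "continuous_on UNIV G'"
    using C1_closed_loop[OF \<open>C1 fFV\<close> \<open>C1 \<phi>LP\<close>] unfolding C1_def by blast
  note matrices = system_matrices_mult_vec[OF f \<phi> G]
  have pac: "abs_continuous_on_interval 0 T p" and pT: "p T = ?c"
    and pder: "AE t in lebesgue_on {0..T}. (p has_vector_derivative
        - (transpose (M_matrix fFV \<phi>LP (\<rho> t) (\<gamma> t) (u t)) *v p t)) (at t)"
    using adj by (auto simp: adjoint_state_def)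
  have \<gamma>: "AE t in lebesgue_on {0..T}. \<gamma> t = \<phi>LP (\<rho> t, u t)"
    using sys by (simp add: solves_system_def)
  have density: "\<exists>g. solves_system fFV \<phi>LP T \<rho>0 v (density_of fFV \<phi>LP T \<rho>0 v) g"
    if "v \<in> U_ad T" for v
    using someI_ex[of "\<lambda>r. \<exists>g. solves_system fFV \<phi>LP T \<rho>0 v r g"] unique[OF that]
    unfolding density_of_def by blast
  have density_u: "density_of fFV \<phi>LP T \<rho>0 u T = \<rho> T"
  proof -
    have "T \<in> {0..T}" using \<open>T > 0\<close> by simp
    then show ?thesis using unique[OF u] density[OF u] sys by metis
  qed
  have "has_L2_gradient T (U_ad T) (\<lambda>v. ?c \<bullet> density_of fFV \<phi>LP T \<rho>0 v T) u
      (\<lambda>t. transpose (N_matrix fFV \<phi>LP (\<rho> t) (\<gamma> t) (u t)) *v p t)"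
  proof (rule terminal_value_has_L2_gradient[OF G contG \<open>T > 0\<close>
        solves_system_imp_solves_ode(1)[OF sys] U_ad_measurable[OF u] U_ad_norm_le[OF u] pac])
    show "AE t in lebesgue_on {0..T}. \<exists>q. (p has_vector_derivative q) (at t) \<and>
        (\<forall>w. q \<bullet> w = - (p t \<bullet> G' (\<rho> t, u t) (w, 0)))"
      using pder \<gamma>
    proof eventually_elim
      case (elim t)
      have "- (transpose (M_matrix fFV \<phi>LP (\<rho> t) (\<gamma> t) (u t)) *v p t) \<bullet> w =
          - (p t \<bullet> G' (\<rho> t, u t) (w, 0))" for w
        unfolding inner_minus_left inner_transpose_mult_vec elim(2) matrices ..
      with elim(1) show ?case by blast
    qed
    show "AE t in lebesgue_on {0..T}. \<forall>h.
        (transpose (N_matrix fFV \<phi>LP (\<rho> t) (\<gamma> t) (u t)) *v p t) \<bullet> h = p t \<bullet> G' (\<rho> t, u t) (0, h)"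
      using \<gamma>
    proof eventually_elim
      case (elim t)
      show ?case unfolding inner_transpose_mult_vec elim matrices by blast
    qed
    show "\<exists>y. solves_ode ?G T v y \<and> y 0 = \<rho> 0 \<and> ?c \<bullet> density_of fFV \<phi>LP T \<rho>0 v T = p T \<bullet> y T"
      if v: "v \<in> U_ad T" for v
    proof -
      obtain g where "solves_system fFV \<phi>LP T \<rho>0 v (density_of fFV \<phi>LP T \<rho>0 v) g"
        using density[OF v] by blast
      from solves_system_imp_solves_ode[OF this] show ?thesis
        using solves_system_imp_solves_ode(2)[OF sys] pT
        by (intro exI[of _ "density_of fFV \<phi>LP T \<rho>0 v"]) simp
    qed
  qed (use U_ad_measurable U_ad_norm_le density_u pT in auto)
  moreover have "has_L2_gradient T (U_ad T) (\<lambda>v. \<theta>S / 2 * S_cost T Nmax v) u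
      (\<lambda>t. (\<theta>S / 2) *\<^sub>R ((2 * pos_part ((\<Sum>i\<in>UNIV. u t $ i) - real Nmax)) *\<^sub>R 1))"
    by (intro has_L2_gradient_cmult S_cost_has_L2_gradient u)
  moreover have "has_L2_gradient T (U_ad T) (\<lambda>v. \<theta>B * B_cost (TV \<nu>) v) u
      (\<lambda>t. \<theta>B *\<^sub>R (\<Sum>i\<in>UNIV. gradTV i t))"
    unfolding B_cost_def using U_ad_subset_L2 u
    by (intro has_L2_gradient_cmult has_L2_gradient_sum has_L2_gradient_mono[OF assms(21)]) auto
  ultimately have "has_L2_gradient T (U_ad T) J u (\<lambda>t.
      transpose (N_matrix fFV \<phi>LP (\<rho> t) (\<gamma> t) (u t)) *v p t
      + (\<theta>S / 2) *\<^sub>R ((2 * pos_part ((\<Sum>i\<in>UNIV. u t $ i) - real Nmax)) *\<^sub>R 1)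
      + \<theta>B *\<^sub>R (\<Sum>i\<in>UNIV. gradTV i t))"
    unfolding assms(17) using U_ad_subset_L2 u by (intro has_L2_gradient_add) auto
  then show grad: "has_L2_gradient T (U_ad T) J u gradJ"
    unfolding assms(22) by simp
  show "AE t in lebesgue_on {0..T}. \<Lambda> t = 0"
    using local_minimizer_stationary[OF loc grad]
    by eventually_elim (simp add: assms(23) vec_eq_iff)
qed

end
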